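(* Let $q$ be a prime power, $n\ge 2$ an integer and $k\le n-1$ a nonnegative integer, and suppose there exist $k$-normal elements in $\mathbb{F}_{q^n}$ over $\mathbb{F}_q$. Then there exists a $k$-normal element of $\mathbb{F}_{q^n}$ whose multiplicative order is at least $$\tau(k,q,n):=4^{(k-n)/q}\cdot q^{\,n-k-\frac{1.1n}{\log\log(q^n-1)}}.$$
   Context: $\log$ denotes the natural logarithm. An element $\alpha\in\mathbb{F}_{q^n}$ is $k$-normal over $\mathbb{F}_q$ if the $\mathbb{F}_q$-vector space spanned by $\alpha,\alpha^q,\dots,\alpha^{q^{n-1}}$ has dimension $n-k$. *)

theory Defs
  imports "HOL-Analysis.Analysis" "HOL-Number_Theory.Number_Theory"
begin

text \<open>The prime subfield-like copy of F_q inside a finite field of order q^n: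
  the set of roots of X^q - X (the unique subfield of order q).\<close>
definition Fq :: "nat \<Rightarrow> ('a::field) set" where
  "Fq q = {x. x ^ q = x}"

definition lin_span :: "('a::field) set \<Rightarrow> 'a set \<Rightarrow> 'a set" where
  "lin_span K S = {(\<Sum>b\<in>B. c b * b) | B c. finite B \<and> B \<subseteq> S \<and> (\<forall>b\<in>B. c b \<in> K)}"

definition lin_indep :: "('a::field) set \<Rightarrow> 'a set \<Rightarrow> bool" where
  "lin_indep K B \<longleftrightarrow> finite B \<and>
     (\<forall>c. (\<forall>b\<in>B. c b \<in> K) \<longrightarrow> (\<Sum>b\<in>B. c b * b) = 0 \<longrightarrow> (\<forall>b\<in>B. c b = 0))"

definition has_dim :: "('a::field) set \<Rightarrow> 'a set \<Rightarrow> nat \<Rightarrow> bool" where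
  "has_dim K V d \<longleftrightarrow> (\<exists>B. B \<subseteq> V \<and> lin_indep K B \<and> lin_span K B = V \<and> card B = d)"

definition k_normal :: "nat \<Rightarrow> nat \<Rightarrow> nat \<Rightarrow> ('a::field) \<Rightarrow> bool" where
  "k_normal q n k \<alpha> \<longleftrightarrow> has_dim (Fq q) (lin_span (Fq q) {\<alpha> ^ (q ^ i) | i. i < n}) (n - k)"

definition mult_ord :: "('a::field) \<Rightarrow> nat" where
  "mult_ord \<alpha> = (LEAST m. m > 0 \<and> \<alpha> ^ m = 1)"

definition tau :: "nat \<Rightarrow> nat \<Rightarrow> nat \<Rightarrow> real" where
  "tau k q n = 4 powr ((real k - real n) / real q) *
     real q powr (real n - real k - 1.1 * real n / ln (ln (real q ^ n - 1)))"

end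

theory Submission
  imports Defs "HOL-Library.Discrete_Functions"
begin

text \<open>
  Put \<open>m = q\<^sup>n - 1\<close> and \<open>F(m) = \<Sum>\<^bsub>d | m\<^esub> \<phi>(d) / d\<close>. As \<open>\<phi>(d)\<close> elements have order \<open>d\<close>, the sum of
  \<open>1 / ord x\<close> over all \<open>x \<noteq> 0\<close> equals \<open>F(m)\<close>, so any set \<open>A\<close> of nonzero elements contains an element
  of order at least \<open>|A| / F(m)\<close>. Let \<open>A\<close> be the set of \<open>k\<close>-normal elements. The \<open>\<bbbF>\<^sub>q\<close>-span \<open>V\<close> of the
  conjugates of one of them is a cyclic \<open>\<bbbF>\<^sub>q[x]\<close>-module with \<open>x\<close> acting as the Frobenius, and all its
  generators, i.e. the elements outside every maximal submodule, are \<open>k\<close>-normal. Removing the maximal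
  submodules one by one, each loses at most the fraction \<open>1 / q\<close> of what is left, because the elements
  left are a union of cosets of the intersection of the submodules removed so far, which is not
  contained in the next one. As this intersection shrinks by a factor of at least \<open>q\<close> each time, there
  are at most \<open>n - k\<close> steps, so \<open>|A| \<ge> (q - 1)\<^bsup>n - k\<^esup>\<close>. Finally, \<open>1 - 1/q \<ge> 4\<^bsup>-1/q\<^esup>\<close>, and the
  claim follows from \<open>F(m) \<le> m\<^bsup>1.1 / ln ln m\<^esup>\<close>.

  For the latter bound, \<open>F(m)\<close> is the product of \<open>1 + a (1 - 1/p)\<close> over the prime powers \<open>p\<^sup>a\<close>
  exactly dividing \<open>m\<close>, so \<open>F(m) \<le> C\<^sub>j m\<^bsup>1/j\<^esup>\<close> where \<open>C\<^sub>j\<close> is a product over the primes below \<open>2\<^sup>j\<close>,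
  and \<open>j\<close> is chosen close to \<open>ln ln m / 0.8\<close>. Working with \<open>F\<close> rather than with the number of
  divisors of \<open>m\<close>, for which the constant 1.1 is almost sharp, leaves enough room to bound the
  number of primes in \<open>[2\<^sup>i, 2\<^bsup>i+1\<^esup>)\<close> just by the number of residues coprime to 6.
\<close>

subsection \<open>The sum of \<open>\<phi>(d) / d\<close> over the divisors\<close>

definition totient_ratio_sum :: "nat \<Rightarrow> real" where
  "totient_ratio_sum m = (\<Sum>d | d dvd m. real (totient d) / real d)"

lemma totient_ratio_sum_pos: "m > 0 \<Longrightarrow> totient_ratio_sum m > 0"
  unfolding totient_ratio_sum_def by (intro sum_pos) (auto intro: dvd_pos_nat)

lemma bij_betw_divisors_mult_coprime:
  fixes m n :: nat
  assumes "coprime m n"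
  shows "bij_betw (\<lambda>(d, e). d * e) ({d. d dvd m} \<times> {e. e dvd n}) {d. d dvd m * n}"
  unfolding bij_betw_def
proof (intro conjI)
  have "gcd (d * e) m = d" "gcd (d * e) n = e" if "d dvd m" "e dvd n" for d e
  proof -
    have "coprime m e" "coprime n d"
      using assms that by (meson coprime_commute coprime_divisors dvd_refl)+
    then show "gcd (d * e) m = d" "gcd (d * e) n = e"
      using that
      by (simp_all add: gcd_mult_left_left_cancel gcd_mult_left_right_cancel gcd_proj1_iff)
  qed
  then show "inj_on (\<lambda>(d, e). d * e) ({d. d dvd m} \<times> {e. e dvd n})"
    by (auto simp: inj_on_def) metis+
  show "(\<lambda>(d, e). d * e) ` ({d. d dvd m} \<times> {e. e dvd n}) = {d. d dvd m * n}"
    by (auto intro: mult_dvd_mono elim!: dvd_productE)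
qed

lemma totient_ratio_sum_mult_coprime:
  assumes "coprime m n"
  shows "totient_ratio_sum (m * n) = totient_ratio_sum m * totient_ratio_sum n"
proof -
  have "totient_ratio_sum (m * n) =
      (\<Sum>(d, e)\<in>{d. d dvd m} \<times> {e. e dvd n}. real (totient (d * e)) / real (d * e))"
    unfolding totient_ratio_sum_def
    by (subst sum.reindex_bij_betw[OF bij_betw_divisors_mult_coprime[OF assms], symmetric])
      (simp add: case_prod_unfold)
  also have "\<dots> = (\<Sum>(d, e)\<in>{d. d dvd m} \<times> {e. e dvd n}.
      real (totient d) / real d * (real (totient e) / real e))"
    using coprime_divisors[OF _ _ assms] by (intro sum.cong) (auto simp: totient_mult_coprime)
  finally show ?thesis
    by (simp add: totient_ratio_sum_def sum_product sum.cartesian_product)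
qed

lemma totient_ratio_sum_prime_power:
  assumes prime_p: "prime p"
  shows "totient_ratio_sum (p ^ a) = 1 + real a * (1 - 1 / real p)"
proof -
  have p_gt_1: "p > 1" using prime_p by (rule prime_gt_1_nat)
  have "{d. d dvd p ^ a} = (\<lambda>i. p ^ i) ` {..a}"
    using divides_primepow_nat[OF prime_p] by (auto simp: image_iff)
  then have "totient_ratio_sum (p ^ a) = (\<Sum>i\<le>a. real (totient (p ^ i)) / real (p ^ i))"
    using p_gt_1 by (simp add: totient_ratio_sum_def sum.reindex inj_on_def)
  also have "\<dots> = 1 + real a * (1 - 1 / real p)"
  proof (induction a)
    case (Suc a)
    have "real (totient (p ^ Suc a)) = real p ^ a * (real p - 1)"
      using prime_p p_gt_1 by (simp add: totient_prime_power_Suc of_nat_diff del: power_Suc)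
    then have "real (totient (p ^ Suc a)) / real (p ^ Suc a) = 1 - 1 / real p"
      using p_gt_1 by (simp add: field_simps)
    with Suc show ?case by (simp add: distrib_right del: power_Suc)
  qed simp
  finally show ?thesis .
qed

lemma totient_ratio_sum_eq_prod:
  assumes "m > 0"
  shows "totient_ratio_sum m =
    (\<Prod>p\<in>prime_factors m. 1 + real (multiplicity p m) * (1 - 1 / real p))"
proof -
  have "totient_ratio_sum (\<Prod>p\<in>P. p ^ e p) = (\<Prod>p\<in>P. 1 + real (e p) * (1 - 1 / real p))"
    if "finite P" "\<And>p. p \<in> P \<Longrightarrow> prime p" for P :: "nat set" and e
    using that
  proof (induction P rule: finite_induct)
    case empty
    then show ?case by (simp add: totient_ratio_sum_def)
  next
    case (insert p P)
    have "coprime p p'" if "p' \<in> P" for p'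
      using that insert.hyps insert.prems by (intro primes_coprime) auto
    then have "coprime (p ^ e p) (\<Prod>p\<in>P. p ^ e p)" by (intro prod_coprime_right) auto
    with insert show ?case
      by (simp add: totient_ratio_sum_mult_coprime totient_ratio_sum_prime_power)
  qed
  from this[of "prime_factors m" "\<lambda>p. multiplicity p m"] show ?thesis
    using prime_factorization_nat[OF assms] by auto
qed

definition local_factor_bound :: "real \<Rightarrow> nat \<Rightarrow> real \<Rightarrow> bool" where
  "local_factor_bound \<epsilon> p C \<longleftrightarrow>
     (\<forall>a::nat. 1 + real a * (1 - 1 / real p) \<le> C * real p powr (\<epsilon> * real a))"

lemma totient_ratio_sum_le_prod:
  assumes factor_bound: "\<And>p. prime p \<Longrightarrow> local_factor_bound \<epsilon> p (C p)"
    and P_props: "finite P" "\<And>p. \<lbrakk>prime p; p \<notin> P\<rbrakk> \<Longrightarrow> C p = 1" "\<And>p. p \<in> P \<Longrightarrow> C p \<ge> 1"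
    and m_pos: "m > 0"
  shows "totient_ratio_sum m \<le> (\<Prod>p\<in>P. C p) * real m powr \<epsilon>"
proof -
  have "totient_ratio_sum m \<le> (\<Prod>p\<in>prime_factors m. C p * real p powr (\<epsilon> * real (multiplicity p m)))"
    unfolding totient_ratio_sum_eq_prod[OF m_pos]
  proof (intro prod_mono conjI)
    fix p assume "p \<in> prime_factors m"
    then have prime_p: "prime p" by (rule in_prime_factors_imp_prime)
    show "0 \<le> 1 + real (multiplicity p m) * (1 - 1 / real p)"
      using prime_gt_1_nat[OF prime_p] by simp
    show "1 + real (multiplicity p m) * (1 - 1 / real p) \<le>
        C p * real p powr (\<epsilon> * real (multiplicity p m))"
      using factor_bound[OF prime_p] by (simp add: local_factor_bound_def)
  qed
  also have "\<dots> = (\<Prod>p\<in>prime_factors m. C p) * (\<Prod>p\<in>prime_factors m. real p ^ multiplicity p m) powr \<epsilon>"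
  proof -
    have "(real p ^ k) powr \<epsilon> = real p powr (\<epsilon> * real k)" if "p \<in> prime_factors m" for p k
      using prime_gt_0_nat[OF in_prime_factors_imp_prime[OF that]]
      by (simp add: powr_powr mult.commute flip: powr_realpow)
    then show ?thesis by (simp add: prod.distrib prod_powr_distrib cong: prod.cong)
  qed
  also have "(\<Prod>p\<in>prime_factors m. real p ^ multiplicity p m) = real m"
    using arg_cong[OF prime_factorization_nat[OF m_pos], of real] by simp
  also have "(\<Prod>p\<in>prime_factors m. C p) = (\<Prod>p\<in>prime_factors m \<inter> P. C p)"
    using P_props by (intro prod.mono_neutral_right) auto
  also have "\<dots> \<le> (\<Prod>p\<in>P. C p)"
    using P_props(1) order_trans[OF zero_le_one P_props(3)] P_props(3) by (intro prod_mono2) auto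
  finally show ?thesis by (simp add: mult_right_mono)
qed

subsection \<open>Local factors for the exponent \<open>1 / 5\<close>\<close>

lemma one_plus_mult_le_power:
  fixes t q :: real
  assumes "- 1 \<le> t" "1 + t \<le> q"
  shows "1 + real n * t \<le> q ^ n"
  using Bernoulli_inequality[of t n] power_mono[of "1 + t" q n] assms by simp

lemma one_minus_mult_mult_power_le_one:
  fixes t q :: real
  assumes "t \<le> 1" "q \<ge> 0" "(1 - t) * q \<le> 1"
  shows "(1 - real n * t) * q ^ n \<le> 1"
proof -
  have "(1 - real n * t) * q ^ n \<le> (1 - t) ^ n * q ^ n"
    using Bernoulli_inequality[of "- t" n] assms by (intro mult_right_mono) auto
  also have "\<dots> = ((1 - t) * q) ^ n" by (simp add: power_mult_distrib)
  also have "\<dots> \<le> 1" using assms by (intro power_le_one) auto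
  finally show ?thesis .
qed

text \<open>Since \<open>1 + a b = (1 + r b) (1 + (a - r) t)\<close> for \<open>t = b / (1 + r b)\<close>, Bernoulli's inequality
  applies to \<open>1 + t \<le> q\<close> above \<open>r\<close> and to \<open>1 - t \<le> 1 / q\<close> below \<open>r\<close>.\<close>
lemma affine_le_power_mult:
  fixes b q :: real and r a :: nat
  assumes b_nonneg: "b \<ge> 0" and q_ge_1: "q \<ge> 1"
    and step_up: "1 + (real r + 1) * b \<le> (1 + real r * b) * q"
    and step_down: "r > 0 \<Longrightarrow> (1 + (real r - 1) * b) * q \<le> 1 + real r * b"
  shows "(1 + real a * b) * q ^ r \<le> (1 + real r * b) * q ^ a"
proof -
  define s where "s = 1 + real r * b"
  define t where "t = b / s"
  have s_pos: "s > 0" using b_nonneg by (simp add: s_def add_pos_nonneg)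
  have t_nonneg: "t \<ge> 0" using b_nonneg s_pos by (simp add: t_def)
  have affine: "1 + (real r + x) * b = s * (1 + x * t)" for x
    using s_pos by (simp add: t_def s_def field_simps)
  show ?thesis
  proof (cases "a \<ge> r")
    case True
    then obtain n where shift: "a = r + n" using le_Suc_ex by blast
    have "1 + t \<le> q" using step_up affine[of 1] s_pos by (simp flip: s_def)
    then have "1 + real n * t \<le> q ^ n" using t_nonneg by (intro one_plus_mult_le_power) auto
    then have "s * (1 + real n * t) * q ^ r \<le> s * q ^ n * q ^ r"
      using s_pos q_ge_1 by (intro mult_right_mono mult_left_mono) auto
    then show ?thesis using affine[of "real n"] by (simp add: shift s_def power_add mult_ac)
  next
    case False
    then obtain n where shift: "r = a + n" using le_Suc_ex[of a r] by auto
    have "s * ((1 - t) * q) \<le> s * 1"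
      using step_down False affine[of "- 1"] by (simp add: mult.assoc flip: s_def)
    then have "(1 - t) * q \<le> 1" using s_pos by (simp only: mult_le_cancel_left_pos)
    moreover have "b \<le> s" using False b_nonneg mult_right_mono[of 1 "real r" b] by (simp add: s_def)
    then have "t \<le> 1" using s_pos by (simp add: t_def)
    ultimately have "(1 - real n * t) * q ^ n \<le> 1"
      using q_ge_1 by (intro one_minus_mult_mult_power_le_one) auto
    then have "s * ((1 - real n * t) * q ^ n) * q ^ a \<le> s * 1 * q ^ a"
      using s_pos q_ge_1 by (intro mult_right_mono mult_left_mono) auto
    moreover have "s * (1 - real n * t) = 1 + real a * b"
      using affine[of "- real n"] by (simp add: shift)
    ultimately have "(1 + real a * b) * q ^ n * q ^ a \<le> s * q ^ a" by (simp flip: mult.assoc)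
    then show ?thesis by (simp add: shift s_def power_add mult_ac)
  qed
qed

lemma affine_le_powr_root:
  fixes b Q C :: real and r a j :: nat
  assumes b_nonneg: "b \<ge> 0" and Q_ge_1: "Q \<ge> 1" and j_pos: "j > 0" and C_pos: "C > 0"
    and step_up: "(1 + (real r + 1) * b) ^ j \<le> (1 + real r * b) ^ j * Q"
    and step_down: "r > 0 \<Longrightarrow> (1 + (real r - 1) * b) ^ j * Q \<le> (1 + real r * b) ^ j"
    and maximum: "(1 + real r * b) ^ j \<le> C ^ j * Q ^ r"
  shows "1 + real a * b \<le> C * Q powr (real a / real j)"
proof -
  define q where "q = Q powr (1 / real j)"
  have q_ge_1: "q \<ge> 1" unfolding q_def using Q_ge_1 by (simp add: ge_one_powr_ge_zero)
  have Q_eq: "Q = q ^ j" using Q_ge_1 j_pos by (simp add: q_def powr_realpow[symmetric] powr_powr)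
  have "(1 + real a * b) * q ^ r \<le> (1 + real r * b) * q ^ a"
  proof (rule affine_le_power_mult[OF b_nonneg q_ge_1])
    show "1 + (real r + 1) * b \<le> (1 + real r * b) * q"
      by (subst power_mono_iff[OF _ _ j_pos, symmetric])
        (use step_up b_nonneg q_ge_1 in \<open>simp_all add: power_mult_distrib flip: Q_eq\<close>)
    show "(1 + (real r - 1) * b) * q \<le> 1 + real r * b" if "r > 0"
      by (subst power_mono_iff[OF _ _ j_pos, symmetric])
        (use step_down that b_nonneg q_ge_1 in \<open>simp_all add: power_mult_distrib flip: Q_eq\<close>)
  qed
  also have "\<dots> \<le> (C * q ^ r) * q ^ a"
  proof (rule mult_right_mono)
    show "1 + real r * b \<le> C * q ^ r"
    proof (subst power_mono_iff[OF _ _ j_pos, symmetric])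
      have "Q ^ r = (q ^ r) ^ j" by (simp add: Q_eq mult.commute flip: power_mult)
      with maximum show "(1 + real r * b) ^ j \<le> (C * q ^ r) ^ j" by (simp add: power_mult_distrib)
    qed (use C_pos b_nonneg q_ge_1 in auto)
  qed (use q_ge_1 in auto)
  finally have "1 + real a * b \<le> C * q ^ a" using q_ge_1 by (simp add: mult_ac)
  also have "q ^ a = Q powr (real a / real j)"
    using Q_ge_1 by (simp add: q_def powr_realpow[symmetric] powr_powr)
  finally show ?thesis .
qed

text \<open>A triple \<open>(p, r, c)\<close> records that \<open>(1 + a (1 - 1/p)) p\<^bsup>-a/5\<^esup>\<close> is maximal at \<open>a = r\<close>,
  with maximum at most \<open>c / 1000\<close>.\<close>
definition fifth_root_table :: "(nat \<times> nat \<times> nat) list" where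
  "fifth_root_table = [(2, 5, 1750), (3, 3, 1552), (5, 2, 1366), (7, 1, 1259), (11, 1, 1182),
    (13, 1, 1152), (17, 1, 1102), (19, 1, 1081), (23, 1, 1046), (29, 1, 1003), (31, 0, 1000)]"

definition fifth_root_const :: "nat \<Rightarrow> real" where
  "fifth_root_const p =
     (case map_of fifth_root_table p of Some (r, c) \<Rightarrow> real c / 1000 | None \<Rightarrow> 1)"

lemma prime_less_32_in_table:
  assumes "prime p" "p < 32"
  shows "p \<in> fst ` set fifth_root_table"
proof (rule ccontr)
  assume not_in_table: "p \<notin> fst ` set fifth_root_table"
  with assms(2) have "p \<in> {0,1,4,6,8,9,10,12,14,15,16,18,20,21,22,24,25,26,27,28,30}"
    unfolding fifth_root_table_def by (simp; presburger)
  moreover have "\<not> 2 dvd p" "\<not> 3 dvd p" "\<not> 5 dvd p" "p \<noteq> 1" "p \<noteq> 0"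
    using assms(1) not_in_table
      primes_dvd_imp_eq[of 2 p] primes_dvd_imp_eq[of 3 p] primes_dvd_imp_eq[of 5 p]
    by (auto simp: fifth_root_table_def)
  ultimately show False by auto
qed

lemma local_factor_bound_fifth_root:
  assumes prime_p: "prime p"
  shows "local_factor_bound (1 / 5) p (fifth_root_const p)"
proof -
  have "1 + real a * (1 - 1 / real p) \<le> fifth_root_const p * real p powr (real a / real 5)" for a
  proof (cases "p < 32")
    case True
    then obtain r c where entry: "(p, r, c) \<in> set fifth_root_table"
      using prime_less_32_in_table[OF prime_p] by auto
    then have "map_of fifth_root_table p = Some (r, c)"
      by (intro map_of_is_SomeI) (auto simp: fifth_root_table_def)
    then show ?thesis
      by (intro affine_le_powr_root[where r = r])
        (use entry in \<open>auto simp: fifth_root_const_def fifth_root_table_def power_divide\<close>)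
  next
    case False
    have "(1 + (1 - 1 / real p)) ^ 5 \<le> 2 ^ 5"
      using False by (intro power_mono) (auto simp: field_simps)
    also have "\<dots> \<le> real p" using False by simp
    finally show ?thesis
      by (intro affine_le_powr_root[where r = 0])
        (use False in \<open>auto simp: fifth_root_const_def fifth_root_table_def\<close>)
  qed
  then show ?thesis by (simp add: local_factor_bound_def)
qed

lemma totient_ratio_sum_le_fifth_root:
  assumes "m > 0"
  shows "totient_ratio_sum m \<le> 8 * real m powr (1 / 5)"
proof -
  let ?P = "fst ` set fifth_root_table"
  have "totient_ratio_sum m \<le> (\<Prod>p\<in>?P. fifth_root_const p) * real m powr (1 / 5)"
  proof (rule totient_ratio_sum_le_prod)
    show "fifth_root_const p = 1" if "p \<notin> ?P" for p
      using that by (simp add: fifth_root_const_def flip: map_of_eq_None_iff)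
    show "fifth_root_const p \<ge> 1" if "p \<in> ?P" for p
      using that by (auto simp: fifth_root_const_def fifth_root_table_def)
  qed (use assms local_factor_bound_fifth_root in auto)
  also have "(\<Prod>p\<in>?P. fifth_root_const p) \<le> 8"
    by (simp add: fifth_root_const_def fifth_root_table_def)
  finally show ?thesis by (simp add: mult_right_mono)
qed

subsection \<open>Local factors for the exponents \<open>1 / j\<close>\<close>

lemma two_powr_ge_affine:
  fixes s :: real
  assumes "s \<ge> 0"
  shows "11 / 8 * s + 3 / 5 \<le> 2 powr s"
proof -
  have ln2_bounds: "11 / 16 \<le> ln (2::real)" "ln (2::real) \<le> 7 / 10"
    using ln_approx_bounds[of 2 3] by (simp_all add: eval_nat_numeral)
  have "2 * (1 + (s - 1) * ln 2) \<le> 2 * exp ((s - 1) * ln 2)"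
    using exp_ge_add_one_self by (intro mult_left_mono) auto
  also have "\<dots> = 2 powr s"
    by (simp add: powr_def left_diff_distrib exp_diff)
  finally show ?thesis
    using ln2_bounds mult_right_mono[OF ln2_bounds(1) assms] by (simp add: algebra_simps)
qed

lemma affine_le_two_powr:
  fixes s b c :: real
  assumes "s \<ge> 0" "b \<le> 11 / 8 * c" "5 / 3 \<le> c"
  shows "1 + b * s \<le> c * 2 powr s"
proof -
  have "1 + b * s \<le> c * (11 / 8 * s + 3 / 5)"
    using assms mult_right_mono[OF assms(2,1)] by (simp add: algebra_simps)
  also have "\<dots> \<le> c * 2 powr s"
    using assms by (intro mult_left_mono two_powr_ge_affine) auto
  finally show ?thesis .
qed

text \<open>For a prime \<open>p \<ge> 2\<^sup>i\<close>, the factor \<open>(1 + a) p\<^bsup>-a/j\<^esup>\<close> is bounded in terms of \<open>d = j - i\<close> alone: as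
  \<open>i / (i + d)\<close> increases with \<open>i\<close>, it suffices to treat the least \<open>i\<close> with \<open>i + d \<ge> 7\<close>. For \<open>d < 6\<close>
  this is \<open>7 - d\<close>, and the maximum is attained at \<open>a = r\<close>; for \<open>d \<ge> 6\<close> it is \<open>1\<close>, and the bound comes from
  an affine minorant of \<open>2\<^sup>x\<close>.\<close>
definition dyadic_weight :: "nat \<Rightarrow> real" where
  "dyadic_weight d = (if d \<ge> 6 then 8 * real (Suc d) / 11
     else let r = (if d = 5 then 4 else if d \<ge> 3 then 2 else 1)
       in (real r + 1) * 2 powr (- real (r * (7 - d)) / 7))"

lemma affine_le_dyadic_weight_small:
  assumes "1 \<le> d" "d < 6"
  shows "1 + real a \<le> dyadic_weight d * 2 powr (real a * real (7 - d) / 7)"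
proof -
  define r where "r = (if d = 5 then 4 else if d \<ge> 3 then 2 else (1::nat))"
  have weight_eq: "dyadic_weight d = (real r + 1) * 2 powr (- real (r * (7 - d)) / 7)"
    using assms by (auto simp: dyadic_weight_def r_def Let_def)
  then have weight_power_eq: "dyadic_weight d ^ 7 = (real r + 1) ^ 7 * 2 powr (- real (r * (7 - d)))"
    by (simp add: power_mult_distrib powr_power)
  have weight_mult_eq: "dyadic_weight d ^ 7 * (2 ^ (7 - d)) ^ r = (real r + 1) ^ 7"
    unfolding weight_power_eq by (simp only: powr_minus powr_realpow zero_less_numeral)
      (simp add: mult.commute flip: power_mult)
  have "d \<in> {1, 2, 3, 4, 5}" using assms by auto
  then have "(real r + 2) ^ 7 \<le> (real r + 1) ^ 7 * 2 ^ (7 - d)"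
      "real r ^ 7 * 2 ^ (7 - d) \<le> (real r + 1) ^ 7"
    by (auto simp: r_def)
  then have "1 + real a * 1 \<le> dyadic_weight d * (2 ^ (7 - d)) powr (real a / real 7)"
    using weight_mult_eq weight_eq by (intro affine_le_powr_root[where r = r]) (auto simp: add_ac)
  then show ?thesis by (simp add: powr_powr mult_ac flip: powr_realpow)
qed

lemma affine_le_dyadic_weight:
  assumes i_bounds: "1 \<le> i" "i < j" and j_ge_7: "7 \<le> j"
  shows "1 + real a \<le> dyadic_weight (j - i) * 2 powr (real a * real i / real j)"
proof (cases "j - i < 6")
  case True
  have "1 + real a \<le> dyadic_weight (j - i) * 2 powr (real a * real (7 - (j - i)) / 7)"
    using i_bounds True by (intro affine_le_dyadic_weight_small) auto
  also have "\<dots> \<le> dyadic_weight (j - i) * 2 powr (real a * real i / real j)"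
  proof (intro mult_left_mono powr_mono)
    define d where "d = j - i"
    have real_d: "real (7 - d) = 7 - real d" "real j = real i + real d"
      using i_bounds True by (auto simp: d_def of_nat_diff)
    have "real d * 7 \<le> real d * real j" using j_ge_7 by (intro mult_left_mono) auto
    then have "(7 - real d) * real j \<le> 7 * real i"
      using real_d(2) by (simp add: left_diff_distrib)
    then have "(7 - real d) / 7 \<le> real i / real j"
      using j_ge_7 by (simp add: pos_le_divide_eq pos_divide_le_eq mult.commute)
    then show "real a * real (7 - (j - i)) / 7 \<le> real a * real i / real j"
      using mult_left_mono[of "(7 - real d) / 7" "real i / real j" "real a"] real_d(1)
      by (simp add: d_def)
  qed (auto simp: dyadic_weight_def Let_def)
  finally show ?thesis .
next
  case False
  define s where "s = real a * real i / real j"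
  have "0 \<le> (real i - 1) * real (j - i)" using i_bounds by simp
  then have "real j \<le> real i * real (Suc (j - i))"
    using i_bounds by (simp add: of_nat_diff algebra_simps)
  then have "real j / real i \<le> real (Suc (j - i))"
    using i_bounds(1) by (simp add: pos_divide_le_eq mult.commute)
  also have "\<dots> = 11 / 8 * dyadic_weight (j - i)" using False by (simp add: dyadic_weight_def)
  finally have "real j / real i \<le> 11 / 8 * dyadic_weight (j - i)" .
  moreover have "5 / 3 \<le> dyadic_weight (j - i)" using False by (simp add: dyadic_weight_def)
  ultimately have "1 + real j / real i * s \<le> dyadic_weight (j - i) * 2 powr s"
    by (intro affine_le_two_powr) (auto simp: s_def)
  then show ?thesis using i_bounds by (simp add: s_def)
qed

lemma dyadic_weight_ge_1: "d > 0 \<Longrightarrow> dyadic_weight d \<ge> 1"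
  using affine_le_dyadic_weight[of 7 "7 + d" 0] by simp

text \<open>The value at \<open>1\<close> accounts for the primes 2 and 3, with weights reduced in \<open>root_const\<close> below
  because of their factors \<open>1 - 1/p\<close>.\<close>
definition dyadic_count :: "nat \<Rightarrow> nat" where
  "dyadic_count i = (if i \<le> 2 then 2 else 3 * 2 ^ (i - 3))"

lemma dyadic_count_Suc_le: "dyadic_count (Suc i) \<le> 2 * dyadic_count i"
proof (cases "i \<le> 2")
  case True
  then show ?thesis by (auto simp: dyadic_count_def)
next
  case False
  then have "Suc i - 3 = Suc (i - 3)" by simp
  then show ?thesis using False by (simp add: dyadic_count_def)
qed

definition primes_between :: "nat \<Rightarrow> nat \<Rightarrow> nat set" where
  "primes_between a b = {p. prime p \<and> a \<le> p \<and> p < b}"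

lemma finite_primes_between: "finite (primes_between a b)"
  by (rule finite_subset[of _ "{..<b}"]) (auto simp: primes_between_def)

text \<open>A number coprime to 6 is determined by its quotient by 3, whose parity gives the remainder.\<close>
lemma card_coprime_6_interval_le:
  fixes a b :: nat
  shows "card {x\<in>{a..<b}. \<not> 2 dvd x \<and> \<not> 3 dvd x} \<le> Suc ((b - 2) div 3) - a div 3" (is "card ?S \<le> _")
proof -
  have "x = 3 * (x div 3) + (if even (x div 3) then 1 else 2)" if "x \<in> ?S" for x
    using that by simp presburger
  then have inj: "inj_on (\<lambda>x. x div 3) ?S" by (metis (no_types, lifting) inj_onI)
  have "x div 3 \<le> (b - 2) div 3" if "x < b" "\<not> 3 dvd x" for x
    using that by presburger
  then have "(\<lambda>x. x div 3) ` ?S \<subseteq> {a div 3..(b - 2) div 3}"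
    by (auto intro: div_le_mono)
  from card_mono[OF _ this] show ?thesis using card_image[OF inj] by simp
qed

lemma card_primes_dyadic_le:
  assumes "i \<ge> 2"
  shows "card (primes_between (2 ^ i) (2 ^ Suc i)) \<le> dyadic_count i"
proof -
  have ge_4: "(4::nat) \<le> 2 ^ i" using power_increasing[OF assms, of "2::nat"] by simp
  have "\<not> 2 dvd p \<and> \<not> 3 dvd p" if "prime p" "p > 3" for p :: nat
    using that primes_dvd_imp_eq[of 2 p] primes_dvd_imp_eq[of 3 p] by auto
  then have "primes_between (2 ^ i) (2 ^ Suc i) \<subseteq> {p\<in>{2 ^ i..<2 ^ Suc i}. \<not> 2 dvd p \<and> \<not> 3 dvd p}"
    using ge_4 unfolding primes_between_def by fastforce
  then have "card (primes_between (2 ^ i) (2 ^ Suc i)) \<le>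
      card {p\<in>{2 ^ i..<2 ^ Suc i}. \<not> 2 dvd p \<and> \<not> 3 dvd (p::nat)}"
    by (intro card_mono) auto
  also have "\<dots> \<le> Suc ((2 ^ Suc i - 2) div 3) - 2 ^ i div 3" by (rule card_coprime_6_interval_le)
  also have "\<dots> \<le> dyadic_count i"
  proof (cases "i = 2")
    case True
    then show ?thesis by (simp add: dyadic_count_def)
  next
    case False
    define N :: nat where "N = 2 ^ (i - 3)"
    have N_props: "2 ^ i = 8 * N" "N \<ge> 1"
      using False assms power_add[of "2::nat" 3 "i - 3"] by (simp_all add: N_def)
    have "Suc ((16 * N - 2) div 3) - 8 * N div 3 \<le> 3 * N"
      using div_times_less_eq_dividend[of "16 * N - 2" 3]
        dividend_less_div_times[of 3 "8 * N"] N_props(2)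
      by linarith
    then show ?thesis using False assms N_props(1) by (simp add: dyadic_count_def N_def)
  qed
  finally show ?thesis .
qed

lemma ln_dyadic_weight_7_bound: "ln (2 ^ 8 * 35 ^ 14 * 3 ^ 63 / 11 ^ 14) \<le> (91 :: real)"
proof -
  have exp_1_ge: "exp (1::real) \<ge> 106 / 39"
    using abs_le_D2[OF e_approx_32] by simp
  have "(2 ^ 8 * 35 ^ 14 * 3 ^ 63) * 39 ^ 91 \<le> 106 ^ 91 * (11 ^ 14 :: real)"
    by simp
  then have "2 ^ 8 * 35 ^ 14 * 3 ^ 63 / 11 ^ 14 \<le> (106 ^ 91 / 39 ^ 91 :: real)"
    by (simp only: divide_le_eq le_divide_eq zero_less_power zero_less_numeral
        if_True times_divide_eq_left)
  also have "\<dots> = (106 / 39) ^ 91" by (rule power_divide[symmetric])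
  also have "\<dots> \<le> exp 1 ^ 91" by (intro power_mono exp_1_ge) auto
  also have "\<dots> = exp (91::real)" by (simp flip: exp_of_nat_mult)
  finally have "ln (2 ^ 8 * 35 ^ 14 * 3 ^ 63 / 11 ^ 14) \<le> ln (exp (91::real))"
    by (subst ln_le_cancel_iff) auto
  then show ?thesis by (simp only: ln_exp)
qed

lemma sum_ln_dyadic_weight_7: "(\<Sum>i=1..<7. real (dyadic_count i) * ln (dyadic_weight (7 - i))) \<le> 13"
proof -
  have "7 * (\<Sum>i=1..<7. real (dyadic_count i) * ln (dyadic_weight (7 - i))) = 7 * (
      2 * ln (56 / 11) + 2 * ln (5 * 2 powr (- 8 / 7)) + 3 * ln (3 * 2 powr (- 6 / 7)) +
      6 * ln (3 * 2 powr (- 8 / 7)) + 12 * ln (2 * 2 powr (- 5 / 7)) + 24 * ln (2 * 2 powr (- 6 / 7)))"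
    by (simp add: numeral_eq_Suc sum.atLeast_Suc_lessThan dyadic_count_def dyadic_weight_def)
  also have "\<dots> = 8 * ln 2 + 14 * ln 35 + 63 * ln 3 - 14 * ln (11::real)"
  proof -
    have "ln (35::real) = ln 5 + ln 7" using ln_mult[of 5 "7::real"] by simp
    moreover have "ln (56::real) = 3 * ln 2 + ln 7"
      using ln_mult[of "2 ^ 3" "7::real"] ln_realpow[of "2::real" 3] by simp
    ultimately show ?thesis by (simp add: ln_mult ln_div ln_powr)
  qed
  also have "\<dots> = ln (2 ^ 8 * 35 ^ 14 * 3 ^ 63 / 11 ^ 14)"
  proof -
    have "8 * ln a + 14 * ln b + 63 * ln c - 14 * ln d = ln (a ^ 8 * b ^ 14 * c ^ 63 / d ^ 14)"
      if "a > 0" "b > 0" "c > 0" "d > 0" for a b c d :: real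
      using that by (simp add: ln_mult ln_div ln_realpow)
    then show ?thesis by this simp_all
  qed
  finally show ?thesis using ln_dyadic_weight_7_bound by simp
qed

lemma sum_dyadic_count_shift_le:
  fixes w :: "nat \<Rightarrow> real"
  assumes "j \<ge> 2" and w_nonneg: "\<And>d. d > 0 \<Longrightarrow> w d \<ge> 0"
  shows "(\<Sum>i=1..<Suc j. real (dyadic_count i) * w (Suc j - i)) \<le>
    2 * (\<Sum>i=1..<j. real (dyadic_count i) * w (j - i)) + 2 * (w j - w (j - 1))"
proof -
  have count_first: "dyadic_count 1 = 2" "dyadic_count (Suc 1) = 2"
    by (simp_all add: dyadic_count_def)
  have "(\<Sum>i=1..<Suc j. real (dyadic_count i) * w (Suc j - i)) =
      2 * w j + (\<Sum>i=Suc 1..<Suc j. real (dyadic_count i) * w (Suc j - i))"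
    using assms(1) count_first(1) by (subst sum.atLeast_Suc_lessThan) (simp_all del: sum.op_ivl_Suc)
  also have "(\<Sum>i=Suc 1..<Suc j. real (dyadic_count i) * w (Suc j - i)) =
      (\<Sum>i=1..<j. real (dyadic_count (Suc i)) * w (j - i))"
    by (subst sum.shift_bounds_Suc_ivl) simp
  also have "\<dots> = 2 * w (j - 1) + (\<Sum>i=Suc 1..<j. real (dyadic_count (Suc i)) * w (j - i))"
    using assms(1) count_first(2) by (subst sum.atLeast_Suc_lessThan) simp_all
  also have "(\<Sum>i=Suc 1..<j. real (dyadic_count (Suc i)) * w (j - i)) \<le>
      (\<Sum>i=Suc 1..<j. 2 * real (dyadic_count i) * w (j - i))"
  proof (intro sum_mono mult_right_mono)
    fix i assume "i \<in> {Suc 1..<j}"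
    then show "w (j - i) \<ge> 0" by (intro w_nonneg) auto
    show "real (dyadic_count (Suc i)) \<le> 2 * real (dyadic_count i)"
      using of_nat_mono[OF dyadic_count_Suc_le[of i], where ?'a = real] by simp
  qed
  also have "\<dots> = 2 * (\<Sum>i=1..<j. real (dyadic_count i) * w (j - i)) - 4 * w (j - 1)"
    using assms(1) count_first(1)
    by (subst (2) sum.atLeast_Suc_lessThan) (auto simp: sum_distrib_left mult.assoc)
  finally show ?thesis by simp
qed

lemma sum_ln_dyadic_weight_le:
  assumes "j \<ge> 7"
  shows "(\<Sum>i=1..<j. real (dyadic_count i) * ln (dyadic_weight (j - i))) \<le> 0.105 * 2 ^ j - 0.3"
  using assms
proof (induction j rule: nat_induct_at_least)
  case base
  show ?case using sum_ln_dyadic_weight_7 by simp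
next
  case (Suc j)
  define w where "w = (\<lambda>d. ln (dyadic_weight d))"
  have "w d \<ge> 0" if "d > 0" for d using dyadic_weight_ge_1[OF that] by (simp add: w_def)
  then have "(\<Sum>i=1..<Suc j. real (dyadic_count i) * w (Suc j - i)) \<le>
      2 * (\<Sum>i=1..<j. real (dyadic_count i) * w (j - i)) + 2 * (w j - w (j - 1))"
    using Suc.hyps by (intro sum_dyadic_count_shift_le) auto
  also have "w j - w (j - 1) = ln ((8 * real (Suc j) / 11) / (8 * real j / 11))"
    using Suc.hyps by (subst ln_div) (auto simp: w_def dyadic_weight_def)
  also have "(8 * real (Suc j) / 11) / (8 * real j / 11) = 1 + 1 / real j"
    using Suc.hyps by (simp add: field_simps)
  also have "ln (1 + 1 / real j) \<le> 1 / real j"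
    using Suc.hyps by (intro ln_add_one_self_le_self) auto
  also have "1 / real j \<le> 0.15" using Suc.hyps by (simp add: field_simps)
  finally show ?case using Suc.IH by (simp add: w_def)
qed

lemma prod_dyadic_weight_le:
  assumes "j \<ge> 7"
  shows "(\<Prod>i=1..<j. dyadic_weight (j - i) ^ dyadic_count i) \<le> exp (0.105 * 2 ^ j - 0.3)"
proof -
  have "(\<Prod>i=1..<j. dyadic_weight (j - i) ^ dyadic_count i) =
      exp (\<Sum>i=1..<j. real (dyadic_count i) * ln (dyadic_weight (j - i)))"
    unfolding exp_sum[OF finite_atLeastLessThan]
  proof (intro prod.cong refl)
    fix i assume "i \<in> {1..<j}"
    then have "dyadic_weight (j - i) > 0" using dyadic_weight_ge_1[of "j - i"] by simp
    then show "dyadic_weight (j - i) ^ dyadic_count i =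
        exp (real (dyadic_count i) * ln (dyadic_weight (j - i)))" by (simp add: exp_of_nat_mult)
  qed
  then show ?thesis using sum_ln_dyadic_weight_le[OF assms] by simp
qed

definition root_const :: "nat \<Rightarrow> nat \<Rightarrow> real" where
  "root_const j p =
    (if p = 2 then dyadic_weight (j - 1) / 2
     else if p = 3 then 4 / 9 * dyadic_weight (j - 1)
     else if p < 2 ^ j then dyadic_weight (j - floor_log p) else 1)"

lemma local_factor_le_Suc: "1 + real a * (1 - 1 / real p) \<le> 1 + real a"
  by (simp add: mult_left_le)

lemma two_powr_three_halves_le:
  fixes x :: real
  assumes "x \<ge> 0"
  shows "2 powr (3 / 2 * x) \<le> 3 powr x"
proof -
  have "2 powr (3 / 2 * x) = (2 powr 3) powr (x / 2)" by (simp only: powr_powr) simp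
  also have "\<dots> \<le> (3 powr 2) powr (x / 2)" using assms by (intro powr_mono2) auto
  also have "\<dots> = 3 powr x" by (simp only: powr_powr) simp
  finally show ?thesis .
qed

lemma
  assumes "j \<ge> 7"
  shows local_factor_bound_root_2: "local_factor_bound (1 / real j) 2 (root_const j 2)"
    and local_factor_bound_root_3: "local_factor_bound (1 / real j) 3 (root_const j 3)"
  unfolding local_factor_bound_def
proof safe
  fix a :: nat
  define s where "s = real a / real j"
  have weight_eq: "dyadic_weight (j - Suc 0) = 8 * real j / 11" and a_eq: "real a = real j * s"
    using assms by (simp_all add: dyadic_weight_def s_def)
  have "1 + (real j / 2) * s \<le> 4 * real j / 11 * 2 powr s"
    using assms by (intro affine_le_two_powr) (auto simp: s_def)
  then show "1 + real a * (1 - 1 / real 2) \<le> root_const j 2 * real 2 powr (1 / real j * real a)"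
    using assms by (simp add: root_const_def weight_eq a_eq)
  have "1 + (4 * real j / 9) * (3 / 2 * s) \<le> 32 * real j / 99 * 2 powr (3 / 2 * s)"
    using assms by (intro affine_le_two_powr) (auto simp: s_def)
  also have "\<dots> \<le> 32 * real j / 99 * 3 powr s"
    by (intro mult_left_mono two_powr_three_halves_le) (auto simp: s_def)
  finally show "1 + real a * (1 - 1 / real 3) \<le> root_const j 3 * real 3 powr (1 / real j * real a)"
    using assms by (simp add: root_const_def weight_eq a_eq)
qed

lemma floor_log_bounds:
  assumes "2 ^ i \<le> p" "p < 2 ^ j"
  shows "floor_log p \<in> {i..<j}" "2 ^ floor_log p \<le> p" "p < 2 ^ Suc (floor_log p)"
proof -
  have "p > 0" using assms(1) by (rule less_le_trans[rotated]) simp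
  then show two_power_floor_log: "2 ^ floor_log p \<le> p" "p < 2 ^ Suc (floor_log p)"
    using floor_log_exp2_le[of p] floor_log_exp2_gt[of p] by auto
  have "floor_log p \<ge> i" using floor_log_le_iff[OF assms(1)] by simp
  moreover have "(2::nat) ^ floor_log p < 2 ^ j" using two_power_floor_log assms by linarith
  ultimately show "floor_log p \<in> {i..<j}" by simp
qed

lemma local_factor_bound_root_dyadic:
  assumes j_ge_7: "j \<ge> 7" and p_bounds: "p \<ge> 4" "p < 2 ^ j"
  shows "local_factor_bound (1 / real j) p (root_const j p)"
  unfolding local_factor_bound_def
proof
  fix a :: nat
  define i where "i = floor_log p"
  have i_bounds: "i \<in> {2..<j}" "2 ^ i \<le> p"
    using floor_log_bounds[of 2 p j] p_bounds by (auto simp: i_def)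
  have "1 + real a * (1 - 1 / real p) \<le> 1 + real a" by (rule local_factor_le_Suc)
  also have "\<dots> \<le> dyadic_weight (j - i) * 2 powr (real a * real i / real j)"
    using i_bounds j_ge_7 by (intro affine_le_dyadic_weight) auto
  also have "2 powr (real a * real i / real j) = (2 ^ i) powr (real a / real j)"
    by (simp add: powr_powr mult_ac flip: powr_realpow)
  also have "dyadic_weight (j - i) * (2 ^ i) powr (real a / real j) \<le>
      dyadic_weight (j - i) * real p powr (real a / real j)"
    using i_bounds(1) dyadic_weight_ge_1[of "j - i"] of_nat_mono[OF i_bounds(2), where ?'a = real]
    by (intro mult_left_mono powr_mono2) auto
  finally show "1 + real a * (1 - 1 / real p) \<le> root_const j p * real p powr (1 / real j * real a)"
    using p_bounds by (simp add: root_const_def i_def)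
qed

lemma local_factor_bound_large:
  assumes "j > 0" "p \<ge> 2 ^ j"
  shows "local_factor_bound (1 / real j) p 1"
  unfolding local_factor_bound_def
proof
  fix a :: nat
  have "1 + real a * (1 - 1 / real p) \<le> 1 + real a" by (rule local_factor_le_Suc)
  also have "1 + real a \<le> 2 ^ a" using Bernoulli_inequality[of 1 a] by simp
  also have "\<dots> = (2 ^ j) powr (real a / real j)"
    using assms(1) by (simp add: powr_powr flip: powr_realpow)
  also have "\<dots> \<le> real p powr (real a / real j)"
    using of_nat_mono[OF assms(2), where ?'a = real] by (intro powr_mono2) auto
  finally show "1 + real a * (1 - 1 / real p) \<le> 1 * real p powr (1 / real j * real a)" by simp
qed

lemma local_factor_bound_root:
  assumes j_ge_7: "j \<ge> 7" and prime_p: "prime p"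
  shows "local_factor_bound (1 / real j) p (root_const j p)"
proof -
  consider "p = 2" | "p = 3" | "p \<ge> 4" "p < 2 ^ j" | "p \<ge> 4" "p \<ge> 2 ^ j"
    using prime_gt_1_nat[OF prime_p] by linarith
  then show ?thesis
  proof cases
    case 4
    then show ?thesis using j_ge_7 local_factor_bound_large[of j p] by (simp add: root_const_def)
  qed (use j_ge_7 local_factor_bound_root_2 local_factor_bound_root_3
      local_factor_bound_root_dyadic in auto)
qed

lemma prod_dyadic_weight_primes_le:
  fixes j :: nat
  defines "Q \<equiv> primes_between 4 (2 ^ j)"
  shows "(\<Prod>p\<in>Q. dyadic_weight (j - floor_log p)) \<le>
    (\<Prod>i=2..<j. dyadic_weight (j - i) ^ dyadic_count i)"
proof -
  have finite_Q: "finite Q" unfolding Q_def by (rule finite_primes_between)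
  have floor_log_Q: "floor_log p \<in> {2..<j}" "2 ^ floor_log p \<le> p" "p < 2 ^ Suc (floor_log p)"
    if "p \<in> Q" for p
    using floor_log_bounds[of 2 p j] that by (auto simp: Q_def primes_between_def)
  have "(\<Prod>p\<in>Q. dyadic_weight (j - floor_log p)) =
      (\<Prod>i=2..<j. \<Prod>p\<in>{p\<in>Q. floor_log p = i}. dyadic_weight (j - floor_log p))"
    using finite_Q floor_log_Q(1) by (intro prod.group[symmetric]) auto
  also have "\<dots> = (\<Prod>i=2..<j. dyadic_weight (j - i) ^ card {p\<in>Q. floor_log p = i})"
    by (intro prod.cong) auto
  also have "\<dots> \<le> (\<Prod>i=2..<j. dyadic_weight (j - i) ^ dyadic_count i)"
  proof (intro prod_mono conjI)
    fix i assume i_bounds: "i \<in> {2..<j}"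
    have weight_ge_1: "dyadic_weight (j - i) \<ge> 1"
      using i_bounds by (intro dyadic_weight_ge_1) auto
    then show "0 \<le> dyadic_weight (j - i) ^ card {p\<in>Q. floor_log p = i}" by simp
    have "p \<in> primes_between (2 ^ i) (2 ^ Suc i)" if "p \<in> Q" "floor_log p = i" for p
      using floor_log_Q(2,3)[OF that(1)] that by (simp add: Q_def primes_between_def)
    then have "card {p\<in>Q. floor_log p = i} \<le> card (primes_between (2 ^ i) (2 ^ Suc i))"
      by (intro card_mono finite_primes_between) auto
    also have "\<dots> \<le> dyadic_count i" using i_bounds by (intro card_primes_dyadic_le) auto
    finally show "dyadic_weight (j - i) ^ card {p\<in>Q. floor_log p = i} \<le>
        dyadic_weight (j - i) ^ dyadic_count i"
      using weight_ge_1 by (intro power_increasing)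
  qed
  finally show ?thesis .
qed

lemma totient_ratio_sum_le_root:
  assumes j_ge_7: "j \<ge> 7" and m_pos: "m > 0"
  shows "totient_ratio_sum m \<le> 2 / 9 * exp (0.105 * 2 ^ j - 0.3) * real m powr (1 / real j)"
proof -
  define Q where "Q = primes_between 4 (2 ^ j)"
  have finite_Q: "finite Q" unfolding Q_def by (rule finite_primes_between)
  have weight_eq: "dyadic_weight (j - Suc 0) = 8 * real j / 11"
    using j_ge_7 by (simp add: dyadic_weight_def)
  have "totient_ratio_sum m \<le> (\<Prod>p\<in>{2, 3} \<union> Q. root_const j p) * real m powr (1 / real j)"
  proof (rule totient_ratio_sum_le_prod)
    show "root_const j p = 1" if "prime p" "p \<notin> {2, 3} \<union> Q" for p
    proof -
      have "p \<ge> 4" using prime_gt_1_nat[OF that(1)] that(2) by simp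
      then show ?thesis using that by (auto simp: root_const_def Q_def primes_between_def)
    qed
    show "root_const j p \<ge> 1" if "p \<in> {2, 3} \<union> Q" for p
      using that j_ge_7 floor_log_bounds[of 2 p j] dyadic_weight_ge_1[of "j - floor_log p"] weight_eq
      by (auto simp: root_const_def Q_def primes_between_def)
  qed (use finite_Q m_pos local_factor_bound_root[OF j_ge_7] in auto)
  also have "(\<Prod>p\<in>{2, 3} \<union> Q. root_const j p) =
      2 / 9 * (dyadic_weight (j - 1) ^ 2 * (\<Prod>p\<in>Q. root_const j p))"
    using finite_Q by (subst prod.union_disjoint)
      (auto simp: Q_def primes_between_def root_const_def power2_eq_square)
  also have "(\<Prod>p\<in>Q. root_const j p) = (\<Prod>p\<in>Q. dyadic_weight (j - floor_log p))"
    by (intro prod.cong) (auto simp: Q_def primes_between_def root_const_def)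
  also have "dyadic_weight (j - 1) ^ 2 * \<dots> \<le> (\<Prod>i=1..<j. dyadic_weight (j - i) ^ dyadic_count i)"
    using j_ge_7 prod_dyadic_weight_primes_le[of j]
    by (subst prod.atLeast_Suc_lessThan)
      (auto simp: Q_def dyadic_count_def numeral_2_eq_2 intro!: mult_left_mono)
  also have "\<dots> \<le> exp (0.105 * 2 ^ j - 0.3)" by (rule prod_dyadic_weight_le[OF j_ge_7])
  finally show ?thesis by (simp add: mult_right_mono)
qed

subsection \<open>The bound \<open>m\<^bsup>1.1 / ln ln m\<^esup>\<close>\<close>

lemma exp_ge_tangent: "exp a * (1 + z - a) \<le> exp (z::real)"
proof -
  have "exp a * (1 + (z - a)) \<le> exp a * exp (z - a)"
    using exp_ge_add_one_self by (intro mult_left_mono) auto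
  then show ?thesis by (simp add: exp_diff algebra_simps)
qed

lemma exp_of_nat_ge: "2.718 ^ k \<le> exp (real k)"
proof -
  have "2.718 \<le> exp (1::real)"
    using abs_le_D2[OF e_approx_32] by simp
  then show ?thesis using power_mono[of "2.718" "exp (1::real)" k] by (simp flip: exp_of_nat_mult)
qed

text \<open>By the tangent at \<open>k\<close>, it suffices to compare with a concave quadratic in \<open>z\<close>, hence to check
  the end points of the interval.\<close>
lemma mult_le_exp_mult_affine:
  fixes B c t l u z :: real and k :: nat
  assumes z_bounds: "l \<le> z" "z \<le> u" "l < u"
    and k_le: "real k \<le> 1 + l" and t_bounds: "t > 0" "u \<le> c * t"
    and at_l: "B * l \<le> 2.718 ^ k * (1 + l - real k) * (c - l / t)"
    and at_u: "B * u \<le> 2.718 ^ k * (1 + u - real k) * (c - u / t)"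
  shows "B * z \<le> exp z * (c - z / t)"
proof -
  define E :: real where "E = 2.718 ^ k"
  define Q where "Q = (\<lambda>x. E * (1 + x - real k) * (c - x / t) - B * x)"
  have E_nonneg: "E \<ge> 0" by (simp add: E_def)
  have "(u - l) * Q z = (u - z) * Q l + (z - l) * Q u + E / t * ((u - l) * ((z - l) * (u - z)))"
    by (simp add: Q_def divide_inverse algebra_simps)
  also have "\<dots> \<ge> 0"
    using z_bounds at_l at_u t_bounds E_nonneg
    by (intro add_nonneg_nonneg mult_nonneg_nonneg) (auto simp: Q_def E_def)
  finally have "B * z \<le> E * (1 + z - real k) * (c - z / t)"
    using z_bounds by (simp add: Q_def zero_le_mult_iff)
  also have "\<dots> \<le> exp z * (c - z / t)"
  proof (rule mult_right_mono)
    have "E * (1 + z - real k) \<le> exp (real k) * (1 + z - real k)"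
      using z_bounds k_le unfolding E_def by (intro mult_right_mono exp_of_nat_ge) auto
    also have "\<dots> \<le> exp z" by (rule exp_ge_tangent)
    finally show "E * (1 + z - real k) \<le> exp z" .
    have "z \<le> c * t" using z_bounds t_bounds by linarith
    then show "0 \<le> c - z / t" using t_bounds by (simp add: pos_divide_le_eq)
  qed
  finally show ?thesis .
qed

text \<open>In the following lemmas \<open>z\<close> stands for \<open>ln ln m\<close>; then \<open>C z \<le> e\<^sup>z (1.1 - z / j)\<close> means that
  \<open>e\<^sup>C m\<^bsup>1/j\<^esup> \<le> m\<^bsup>1.1/z\<^esup>\<close>.\<close>
lemma mult_le_exp_mult_fifth:
  fixes z :: real
  assumes "0 < z" "z \<le> 5.15"
  shows "25 / 12 * z \<le> exp z * (1.1 - z / 5)"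
proof -
  consider "z \<le> 1.6" | "1.6 \<le> z" "z \<le> 3" | "3 \<le> z" "z \<le> 4.3" | "4.3 \<le> z"
    by linarith
  then show ?thesis
  proof cases
    case 1
    with assms show ?thesis by (intro mult_le_exp_mult_affine[of 0 z "1.6" 1]) auto
  next
    case 2
    then show ?thesis by (intro mult_le_exp_mult_affine[of "1.6" z 3 2]) (auto simp: eval_nat_numeral)
  next
    case 3
    then show ?thesis by (intro mult_le_exp_mult_affine[of 3 z "4.3" 3]) (auto simp: eval_nat_numeral)
  next
    case 4
    with assms show ?thesis
      by (intro mult_le_exp_mult_affine[of "4.3" z "5.15" 5]) (auto simp: eval_nat_numeral)
  qed
qed

lemma mult_le_exp_mult_seventh:
  fixes z :: real
  assumes "5.15 \<le> z" "z \<le> 6.4"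
  shows "11.65 * z \<le> exp z * (1.1 - z / 7)"
proof (cases "z \<le> 6")
  case True
  with assms show ?thesis
    by (intro mult_le_exp_mult_affine[of "5.15" z 6 5]) (auto simp: eval_nat_numeral)
next
  case False
  with assms show ?thesis
    by (intro mult_le_exp_mult_affine[of 6 z "6.4" 6]) (auto simp: eval_nat_numeral)
qed

lemma mult_two_power_le_exp: "0.28 * real j * 2 ^ j \<le> exp (0.8 * real j)"
proof -
  define \<kappa> where "\<kappa> = 0.8 - ln (2::real)"
  have kappa_ge: "\<kappa> \<ge> 0.8 - 25 / 36" using ln2_le_25_over_36 by (simp add: \<kappa>_def)
  have "0.28 * real j \<le> 2.718 * ((0.8 - 25 / 36) * real j)" by simp
  also have "\<dots> \<le> exp 1 * (\<kappa> * real j)"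
    using exp_of_nat_ge[of 1] kappa_ge by (intro mult_mono mult_right_mono) auto
  also have "\<dots> \<le> exp (\<kappa> * real j)" using exp_ge_tangent[of 1 "\<kappa> * real j"] by simp
  also have "\<dots> = exp (0.8 * real j) / 2 ^ j"
    by (simp add: \<kappa>_def left_diff_distrib exp_diff powr_def flip: powr_realpow)
  finally show ?thesis by (simp add: field_simps)
qed

lemma mult_le_exp_mult_inverse_nat:
  fixes z :: real and j :: nat
  assumes j_ge_8: "j \<ge> 8" and z_bounds: "0.8 * real j \<le> z" "z \<le> 0.8 * real j + 0.8"
  shows "0.105 * 2 ^ j * z \<le> exp z * (1.1 - z / real j)"
proof -
  define s where "s = z - 0.8 * real j"
  have z_eq: "z = 0.8 * real j + s" by (simp add: s_def)
  have s_bounds: "0 \<le> s" "s \<le> 0.8" using z_bounds by (auto simp: s_def)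
  have "0.105 * 2 ^ j * z = (0.28 * real j * 2 ^ j) * (0.375 * z / real j)"
    using j_ge_8 by simp
  also have "\<dots> \<le> exp (0.8 * real j) * (0.375 * z / real j)"
    using z_bounds by (intro mult_right_mono mult_two_power_le_exp) auto
  also have "\<dots> \<le> exp (0.8 * real j) * ((1 + s) * (1.1 - z / real j))"
  proof (rule mult_left_mono)
    have "0 \<le> s * (0.3 * real j - 1.375 - s)"
      using s_bounds j_ge_8 by (intro mult_nonneg_nonneg) auto
    also have "\<dots> = (1 + s) * (1.1 * real j - z) - 0.375 * z"
      unfolding z_eq by (simp add: field_simps)
    finally have "0.375 * z \<le> (1 + s) * (1.1 * real j - z)" by simp
    then have "0.375 * z / real j \<le> (1 + s) * (1.1 * real j - z) / real j"
      using j_ge_8 by (intro divide_right_mono) auto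
    also have "\<dots> = (1 + s) * (1.1 - z / real j)" using j_ge_8 by (simp add: field_simps)
    finally show "0.375 * z / real j \<le> (1 + s) * (1.1 - z / real j)" .
  qed auto
  also have "\<dots> = (exp (0.8 * real j) * (1 + z - 0.8 * real j)) * (1.1 - z / real j)"
    by (simp add: s_def)
  also have "\<dots> \<le> exp z * (1.1 - z / real j)"
    using z_bounds j_ge_8 by (intro mult_right_mono exp_ge_tangent) (simp add: field_simps)
  finally show ?thesis .
qed

lemma le_powr_if_ln_ln_le:
  fixes y c C \<epsilon> F :: real
  assumes y_gt: "y > 1" "ln (ln y) > 0" and F_le: "F \<le> exp C * y powr \<epsilon>"
    and C_le: "C * ln (ln y) \<le> ln y * (c - \<epsilon> * ln (ln y))"
  shows "F \<le> y powr (c / ln (ln y))"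
proof -
  have "C + \<epsilon> * ln y \<le> c / ln (ln y) * ln y" using C_le y_gt by (simp add: field_simps)
  then have "exp C * y powr \<epsilon> \<le> y powr (c / ln (ln y))"
    using y_gt by (simp add: powr_def flip: exp_add)
  with F_le show ?thesis by simp
qed

lemma eight_le_exp: "8 \<le> exp (25 / 12 :: real)"
proof -
  have "(8::real) = exp (3 * ln 2)" using exp_of_nat_mult[of 3 "ln (2::real)"] by simp
  also have "\<dots> \<le> exp (25 / 12)" using ln2_le_25_over_36 by simp
  finally show ?thesis .
qed

lemma exp_le_nine_halves: "exp 1.49 \<le> (9 / 2 :: real)"
proof -
  have "exp (1.5::real) ^ 2 = exp 1 ^ 3" by (simp flip: exp_of_nat_mult)
  also have "\<dots> \<le> 2.72 ^ 3" using e_less_272 by (intro power_mono) auto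
  also have "\<dots> \<le> (9 / 2) ^ 2" by (simp add: eval_nat_numeral)
  finally have "exp (1.5::real) \<le> 9 / 2" by (rule power2_le_imp_le) auto
  moreover have "exp (1.49::real) \<le> exp 1.5" by simp
  ultimately show ?thesis by linarith
qed

lemma totient_ratio_sum_le_exp_fifth_root:
  assumes "m > 0"
  shows "totient_ratio_sum m \<le> exp (25 / 12) * real m powr (1 / 5)"
  using totient_ratio_sum_le_fifth_root[OF assms] eight_le_exp
  by (meson mult_right_mono order_trans powr_ge_zero)

lemma totient_ratio_sum_le_exp_seventh_root:
  assumes "m > 0"
  shows "totient_ratio_sum m \<le> exp 11.65 * real m powr (1 / 7)"
proof -
  have "2 / 9 * exp (0.105 * 2 ^ 7 - 0.3) \<le> 1 / exp 1.49 * exp (13.14::real)"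
    using exp_le_nine_halves by (intro mult_mono) (auto simp: field_simps)
  also have "\<dots> = exp 11.65" by (simp flip: exp_diff)
  finally have "2 / 9 * exp (0.105 * 2 ^ 7 - 0.3) * real m powr (1 / 7) \<le>
      exp 11.65 * real m powr (1 / 7)"
    by (rule mult_right_mono) simp
  with totient_ratio_sum_le_root[OF order_refl assms] show ?thesis by simp
qed

lemma totient_ratio_sum_le_exp_root:
  assumes "j \<ge> 7" "m > 0"
  shows "totient_ratio_sum m \<le> exp (0.105 * 2 ^ j) * real m powr (1 / real j)"
proof -
  have "2 / 9 * exp (0.105 * 2 ^ j - 0.3) \<le> 1 * exp (0.105 * 2 ^ j :: real)"
    by (intro mult_mono) auto
  then have "2 / 9 * exp (0.105 * 2 ^ j - 0.3) * real m powr (1 / real j) \<le>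
      exp (0.105 * 2 ^ j) * real m powr (1 / real j)"
    by (intro mult_right_mono) auto
  then show ?thesis using totient_ratio_sum_le_root[OF assms] by linarith
qed

lemma ln_nat_gt_1: "m \<ge> 3 \<Longrightarrow> ln (real m) > 1"
  using ln3_gt_1 ln_le_cancel_iff[of 3 "real m"] by linarith

theorem totient_ratio_sum_le_powr:
  assumes "m \<ge> 3"
  shows "totient_ratio_sum m \<le> real m powr (1.1 / ln (ln (real m)))"
proof -
  define z where "z = ln (ln (real m))"
  have ln_m: "ln (real m) > 1" by (rule ln_nat_gt_1[OF assms])
  then have z_pos: "z > 0" and exp_z: "exp z = ln (real m)" by (simp_all add: z_def)
  have m_pos: "m > 0" using assms by simp
  have bound: ?thesis
    if "totient_ratio_sum m \<le> exp C * real m powr \<epsilon>" "C * z \<le> exp z * (1.1 - \<epsilon> * z)" for C \<epsilon>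
    using that assms z_pos by (intro le_powr_if_ln_ln_le) (auto simp: exp_z z_def)
  consider "z \<le> 5.15" | "5.15 \<le> z" "z \<le> 6.4" | "6.4 \<le> z" by linarith
  then show ?thesis
  proof cases
    case 1
    show ?thesis
      using bound[OF totient_ratio_sum_le_exp_fifth_root[OF m_pos]]
        mult_le_exp_mult_fifth[OF z_pos 1] by simp
  next
    case 2
    show ?thesis
      using bound[OF totient_ratio_sum_le_exp_seventh_root[OF m_pos]]
        mult_le_exp_mult_seventh[OF 2] by simp
  next
    case 3
    define j where "j = nat \<lfloor>z / 0.8\<rfloor>"
    have j_bounds: "real j \<le> z / 0.8" "z / 0.8 < real j + 1"
      using z_pos unfolding j_def by (auto simp: of_nat_nat) linarith+
    have "j \<ge> 8" using 3 unfolding j_def by (simp add: le_nat_iff le_floor_iff)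
    then show ?thesis
      using bound[OF totient_ratio_sum_le_exp_root[of j m]] m_pos j_bounds
        mult_le_exp_mult_inverse_nat[of j z] by simp
  qed
qed

subsection \<open>Multiplicative orders in finite fields\<close>

lemma card_field_gt_1: "CARD('a::{field,finite}) > 1"
  using card_mono[of UNIV "{0, 1::'a}"] by simp

definition ring_of_field :: "'a::field ring" where
  "ring_of_field = \<lparr>carrier = UNIV, monoid.mult = (*), one = 1, ring.zero = 0, add = (+)\<rparr>"

lemma field_ring_of_field: "field ring_of_field"
proof -
  have "\<exists>y. x + y = 0" for x :: 'a by (rule exI[of _ "- x"]) simp
  moreover have "\<exists>y. x * y = 1" if "x \<noteq> 0" for x :: 'a
    by (rule exI[of _ "inverse x"]) (use that in simp)
  ultimately show ?thesis
    unfolding ring_of_field_def by unfold_locales (auto simp: algebra_simps Units_def)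
qed

definition unit_group :: "'a::field monoid" where
  "unit_group = mult_of ring_of_field"

lemma group_unit_group: "group unit_group"
  unfolding unit_group_def by (rule field.field_mult_group[OF field_ring_of_field])

lemma
  shows carrier_unit_group: "carrier unit_group = UNIV - {0}"
    and one_unit_group: "\<one>\<^bsub>unit_group\<^esub> = 1"
    and pow_unit_group: "x [^]\<^bsub>unit_group\<^esub> (m::nat) = x ^ m"
  by (simp_all add: unit_group_def ring_of_field_def)
    (induction m; simp add: nat_pow_def mult.commute)

lemma order_unit_group: "Coset.order (unit_group :: 'a::{field,finite} monoid) = CARD('a) - 1"
  by (simp add: Coset.order_def carrier_unit_group card_Diff_singleton)

lemma
  fixes x :: "'a::{field,finite}"
  assumes "x \<noteq> 0"
  shows mult_ord_eq_group_ord: "mult_ord x = group.ord unit_group x"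
    and mult_ord_dvd_iff: "mult_ord x dvd m \<longleftrightarrow> x ^ m = 1"
    and mult_ord_dvd_card_minus_1: "mult_ord x dvd CARD('a) - 1"
    and mult_ord_pos: "mult_ord x > 0"
proof -
  interpret group "unit_group :: 'a monoid" by (rule group_unit_group)
  have x_mem: "x \<in> carrier unit_group" using assms by (simp add: carrier_unit_group)
  have ord_dvd_iff: "ord x dvd m \<longleftrightarrow> x ^ m = 1" for m
    using pow_eq_id[OF x_mem, of m] by (simp add: pow_unit_group one_unit_group)
  have ord_pos: "ord x > 0" using ord_ge_1[OF _ x_mem] by simp
  show mult_ord_eq: "mult_ord x = ord x"
    unfolding mult_ord_def
    by (intro Least_equality) (auto simp: ord_pos simp flip: ord_dvd_iff intro: dvd_imp_le)
  show "mult_ord x dvd m \<longleftrightarrow> x ^ m = 1" "mult_ord x > 0"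
    unfolding mult_ord_eq by (rule ord_dvd_iff ord_pos)+
  show "mult_ord x dvd CARD('a) - 1"
    unfolding mult_ord_eq using ord_dvd_group_order[OF x_mem] by (simp add: order_unit_group)
qed

lemma mult_ord_generator_exists: "\<exists>g::'a::{field,finite}. g \<noteq> 0 \<and> mult_ord g = CARD('a) - 1"
proof -
  let ?R = "ring_of_field :: 'a ring"
  interpret R: field ?R by (rule field_ring_of_field)
  interpret group "unit_group :: 'a monoid" by (rule group_unit_group)
  obtain g where generator: "g \<in> carrier (unit_group :: 'a monoid)"
      "carrier unit_group = {g [^]\<^bsub>?R\<^esub> i | i::nat. i \<in> UNIV}"
    using R.finite_field_mult_group_has_gen by (auto simp: unit_group_def)
  then have "generate unit_group {g} = carrier unit_group"
    using generate_pow_on_finite_carrier[OF _ generator(1)]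
    by (simp add: unit_group_def nat_pow_mult_of)
  then have "ord g = CARD('a) - 1"
    using generate_pow_card[OF generator(1)] order_unit_group[where ?'a = 'a]
    by (simp add: Coset.order_def)
  then show ?thesis
    using generator(1) mult_ord_eq_group_ord[of g] by (auto simp: carrier_unit_group)
qed

lemma card_mult_ord_eq:
  assumes d_dvd: "d dvd CARD('a::{field,finite}) - 1"
  shows "card {x::'a. x \<noteq> 0 \<and> mult_ord x = d} = totient d"
proof -
  let ?R = "ring_of_field :: 'a ring"
  interpret R: field ?R by (rule field_ring_of_field)
  interpret group "unit_group :: 'a monoid" by (rule group_unit_group)
  obtain g :: 'a where generator: "g \<noteq> 0" "mult_ord g = CARD('a) - 1"
    using mult_ord_generator_exists by blast
  obtain e where card_eq: "CARD('a) - 1 = e * d" using d_dvd by (metis dvd_def mult.commute)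
  have "CARD('a) - 1 > 0" using card_field_gt_1[where ?'a = 'a] by simp
  then have "e \<noteq> 0" using card_eq by (intro notI) simp
  then have "ord (g ^ e) = d"
    using ord_pow[of g e] generator card_eq
    by (simp add: carrier_unit_group pow_unit_group mult_ord_eq_group_ord)
  then have "card {x \<in> carrier unit_group. ord x = d} = phi' d"
    using d_dvd generator(1) by (intro R.num_elems_of_ord_eq_phi'[folded unit_group_def])
      (auto simp: order_unit_group carrier_unit_group)
  also have "{x \<in> carrier unit_group. ord x = d} = {x::'a. x \<noteq> 0 \<and> mult_ord x = d}"
    by (auto simp: mult_ord_eq_group_ord carrier_unit_group)
  also have "phi' d = totient d"
    unfolding phi'_def totient_def by (intro arg_cong[of _ _ card]) (auto simp: totatives_def)
  finally show ?thesis .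
qed

lemma card_roots_of_unity:
  assumes d_dvd: "d dvd CARD('a::{field,finite}) - 1"
  shows "card {x::'a. x ^ d = 1} = d"
proof -
  have "CARD('a) - 1 > 0" using card_field_gt_1[where ?'a = 'a] by simp
  then have "d > 0" using dvd_pos_nat[OF _ d_dvd] by simp
  then have "x ^ d = 1 \<longleftrightarrow> x \<noteq> 0 \<and> mult_ord x dvd d" for x :: 'a
    by (cases "x = 0") (simp_all add: mult_ord_dvd_iff power_0_left)
  then have "{x::'a. x ^ d = 1} = (\<Union>e\<in>{e. e dvd d}. {x. x \<noteq> 0 \<and> mult_ord x = e})" by auto
  also have "card \<dots> = (\<Sum>e | e dvd d. card {x::'a. x \<noteq> 0 \<and> mult_ord x = e})"
    using \<open>d > 0\<close> by (intro card_UN_disjoint) auto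
  also have "\<dots> = (\<Sum>e | e dvd d. totient e)"
    using d_dvd by (intro sum.cong refl card_mult_ord_eq) (auto intro: dvd_trans)
  finally show ?thesis by (simp add: totient_divisor_sum)
qed

lemma sum_inverse_mult_ord:
  "(\<Sum>x\<in>UNIV - {0::'a::{field,finite}}. 1 / real (mult_ord x)) = totient_ratio_sum (CARD('a) - 1)"
proof -
  let ?m = "CARD('a) - 1"
  have "?m > 0" using card_field_gt_1[where ?'a = 'a] by simp
  then have "(\<Sum>x\<in>UNIV - {0::'a}. 1 / real (mult_ord x)) =
      (\<Sum>d | d dvd ?m. \<Sum>x\<in>{x\<in>UNIV - {0}. mult_ord x = d}. 1 / real (mult_ord (x::'a)))"
    using mult_ord_dvd_card_minus_1 by (intro sum.group[symmetric]) auto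
  also have "\<dots> = (\<Sum>d | d dvd ?m. real (card {x::'a. x \<noteq> 0 \<and> mult_ord x = d}) / real d)"
    by (intro sum.cong) auto
  finally show ?thesis by (simp add: card_mult_ord_eq totient_ratio_sum_def)
qed

lemma mult_ord_ge_exists:
  fixes A :: "'a::{field,finite} set"
  assumes "A \<noteq> {}" "0 \<notin> A"
  shows "\<exists>x\<in>A. real (card A) \<le> real (mult_ord x) * totient_ratio_sum (CARD('a) - 1)"
proof (rule ccontr)
  let ?T = "totient_ratio_sum (CARD('a) - 1)"
  assume "\<not> ?thesis"
  then have ord_less: "real (mult_ord x) * ?T < real (card A)" if "x \<in> A" for x
    using that by (simp add: not_le)
  have ord_pos: "mult_ord x > 0" if "x \<in> A" for x
    using mult_ord_pos[of x] that assms(2) by blast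
  have "?T = (\<Sum>x\<in>A. ?T / real (card A))" using assms(1) by simp
  also have "\<dots> < (\<Sum>x\<in>A. 1 / real (mult_ord x))"
  proof (rule sum_strict_mono)
    show "?T / real (card A) < 1 / real (mult_ord x)" if "x \<in> A" for x
      using ord_less[OF that] ord_pos[OF that] assms(1) by (simp add: field_simps card_gt_0_iff)
  qed (use assms in auto)
  also have "\<dots> \<le> ?T"
    unfolding sum_inverse_mult_ord[symmetric] using assms(2) by (intro sum_mono2) auto
  finally show False by simp
qed

subsection \<open>Generators of cyclic modules\<close>

text \<open>The ring is a subset of a type because \<open>\<bbbF>\<^sub>q[x]\<close> depends on the number \<open>q\<close>.\<close>
locale subring_module =
  fixes R :: "'r::comm_ring_1 set" and scale :: "'r \<Rightarrow> 'm::ab_group_add \<Rightarrow> 'm" (infixr "\<cdot>" 75)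
  assumes one_mem: "1 \<in> R"
    and diff_mem: "\<lbrakk>a \<in> R; b \<in> R\<rbrakk> \<Longrightarrow> a - b \<in> R"
    and mult_mem: "\<lbrakk>a \<in> R; b \<in> R\<rbrakk> \<Longrightarrow> a * b \<in> R"
    and scale_right_distrib: "a \<in> R \<Longrightarrow> a \<cdot> (x + y) = a \<cdot> x + a \<cdot> y"
    and scale_left_distrib: "\<lbrakk>a \<in> R; b \<in> R\<rbrakk> \<Longrightarrow> (a + b) \<cdot> x = a \<cdot> x + b \<cdot> x"
    and scale_scale: "\<lbrakk>a \<in> R; b \<in> R\<rbrakk> \<Longrightarrow> a \<cdot> b \<cdot> x = (a * b) \<cdot> x"
    and scale_one: "1 \<cdot> x = x"
begin

lemma zero_mem: "0 \<in> R"
  using diff_mem[OF one_mem one_mem] by simp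

lemma add_mem: "\<lbrakk>a \<in> R; b \<in> R\<rbrakk> \<Longrightarrow> a + b \<in> R"
  using diff_mem[of a "0 - b"] diff_mem[of 0 b] zero_mem by simp

lemma prod_mem: "(\<And>i. i \<in> I \<Longrightarrow> a i \<in> R) \<Longrightarrow> prod a I \<in> R"
  by (induction I rule: infinite_finite_induct) (auto intro: one_mem mult_mem)

lemma scale_zero_left: "0 \<cdot> x = 0"
  using scale_left_distrib[OF zero_mem zero_mem, of x] by simp

lemma scale_zero_right: "a \<in> R \<Longrightarrow> a \<cdot> 0 = 0"
  using scale_right_distrib[of a 0 0] by simp

lemma scale_diff_left: "\<lbrakk>a \<in> R; b \<in> R\<rbrakk> \<Longrightarrow> (a - b) \<cdot> x = a \<cdot> x - b \<cdot> x"
  using scale_left_distrib[OF diff_mem, of a b b x] by (simp add: eq_diff_eq)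

definition submodule :: "'m set \<Rightarrow> bool" where
  "submodule W \<longleftrightarrow> 0 \<in> W \<and> (\<forall>x\<in>W. \<forall>y\<in>W. x + y \<in> W) \<and> (\<forall>a\<in>R. \<forall>x\<in>W. a \<cdot> x \<in> W)"

lemma submodule_zero: "submodule W \<Longrightarrow> 0 \<in> W"
  by (simp add: submodule_def)

lemma submodule_add: "\<lbrakk>submodule W; x \<in> W; y \<in> W\<rbrakk> \<Longrightarrow> x + y \<in> W"
  by (simp add: submodule_def)

lemma submodule_scale: "\<lbrakk>submodule W; a \<in> R; x \<in> W\<rbrakk> \<Longrightarrow> a \<cdot> x \<in> W"
  by (simp add: submodule_def)

lemma submodule_diff:
  assumes "submodule W" "x \<in> W" "y \<in> W"
  shows "x - y \<in> W"
proof -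
  have "(0 - 1) \<cdot> y = - y"
    using scale_diff_left[OF zero_mem one_mem, of y] by (simp add: scale_zero_left scale_one)
  then have "- y \<in> W"
    using submodule_scale[OF assms(1) diff_mem[OF zero_mem one_mem] assms(3)] by simp
  then show ?thesis using submodule_add[OF assms(1,2)] by force
qed

lemma submodule_Inter: "(\<And>W. W \<in> \<W> \<Longrightarrow> submodule W) \<Longrightarrow> submodule (\<Inter>\<W>)"
  by (simp add: submodule_def)

definition cyclic :: "'m \<Rightarrow> 'm set" where
  "cyclic v = (\<lambda>a. a \<cdot> v) ` R"

lemma submodule_cyclic: "submodule (cyclic v)"
  unfolding submodule_def cyclic_def
proof (intro conjI ballI)
  show "0 \<in> (\<lambda>a. a \<cdot> v) ` R"
    by (rule image_eqI[OF _ zero_mem]) (simp add: scale_zero_left)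
  show "x + y \<in> (\<lambda>a. a \<cdot> v) ` R" if "x \<in> (\<lambda>a. a \<cdot> v) ` R" "y \<in> (\<lambda>a. a \<cdot> v) ` R" for x y
    using that add_mem by (auto simp flip: scale_left_distrib)
  show "a \<cdot> x \<in> (\<lambda>a. a \<cdot> v) ` R" if "a \<in> R" "x \<in> (\<lambda>a. a \<cdot> v) ` R" for a x
    using that mult_mem by (auto simp: scale_scale)
qed

lemma cyclic_self: "v \<in> cyclic v"
  unfolding cyclic_def by (rule image_eqI[OF _ one_mem]) (simp add: scale_one)

lemma cyclic_subset_iff: "submodule W \<Longrightarrow> cyclic v \<subseteq> W \<longleftrightarrow> v \<in> W"
  using cyclic_self by (auto simp: cyclic_def submodule_scale)

definition maximal_submodule :: "'m set \<Rightarrow> 'm set \<Rightarrow> bool" where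
  "maximal_submodule V M \<longleftrightarrow> submodule M \<and> M \<subset> V \<and>
     (\<forall>W. submodule W \<longrightarrow> M \<subseteq> W \<longrightarrow> W \<subseteq> V \<longrightarrow> W = M \<or> W = V)"

lemma maximal_submodule_exists:
  assumes "finite V" "submodule W" "W \<subset> V"
  shows "\<exists>M. maximal_submodule V M \<and> W \<subseteq> M"
proof -
  let ?proper = "{W. submodule W \<and> W \<subset> V}"
  have "finite ?proper" using assms(1) by (auto intro: finite_subset[of _ "Pow V"])
  moreover have "W \<in> ?proper" using assms(2,3) by simp
  ultimately obtain M where "M \<in> ?proper" "W \<subseteq> M" "\<forall>W'\<in>?proper. M \<subseteq> W' \<longrightarrow> M = W'"
    using finite_has_maximal2[of ?proper W] by auto
  then show ?thesis by (intro exI[of _ M]) (auto simp: maximal_submodule_def)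
qed

lemma maximal_submodule_span:
  assumes submodule_V: "submodule V" and maximal: "maximal_submodule V M"
    and x_mem: "x \<in> V" "x \<notin> M" and y_mem: "y \<in> V"
  obtains m a where "m \<in> M" "a \<in> R" "y = m + a \<cdot> x"
proof -
  define W where "W = {m + a \<cdot> x | m a. m \<in> M \<and> a \<in> R}"
  have W_intro: "m + a \<cdot> x \<in> W" if "m \<in> M" "a \<in> R" for m a
    using that by (auto simp: W_def)
  have M_sub: "submodule M" "M \<subseteq> V" using maximal by (auto simp: maximal_submodule_def)
  have "submodule W"
    unfolding submodule_def
  proof (intro conjI ballI)
    show "0 \<in> W"
      using W_intro[OF submodule_zero[OF M_sub(1)] zero_mem] by (simp add: scale_zero_left)
  next
    fix u v assume "u \<in> W" "v \<in> W"
    then obtain m a l b where witnesses: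
      "m \<in> M" "a \<in> R" "u = m + a \<cdot> x" "l \<in> M" "b \<in> R" "v = l + b \<cdot> x"
      unfolding W_def by blast
    have "u + v = (m + l) + (a + b) \<cdot> x"
      using witnesses by (simp add: scale_left_distrib algebra_simps)
    then show "u + v \<in> W"
      using W_intro[OF submodule_add[OF M_sub(1) witnesses(1,4)] add_mem[OF witnesses(2,5)]] by simp
  next
    fix b u assume b_mem: "b \<in> R" and "u \<in> W"
    then obtain m a where witnesses: "m \<in> M" "a \<in> R" "u = m + a \<cdot> x" unfolding W_def by blast
    have "b \<cdot> u = b \<cdot> m + (b * a) \<cdot> x"
      using b_mem witnesses by (simp add: scale_right_distrib scale_scale)
    then show "b \<cdot> u \<in> W"
      using W_intro[OF submodule_scale[OF M_sub(1) b_mem witnesses(1)]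
          mult_mem[OF b_mem witnesses(2)]] by simp
  qed
  moreover have "M \<subseteq> W" using W_intro[OF _ zero_mem] by (auto simp: scale_zero_left)
  moreover have "W \<subseteq> V"
    using submodule_V M_sub(2) x_mem(1) by (auto simp: W_def intro!: submodule_add submodule_scale)
  moreover have "x \<in> W"
    using W_intro[OF submodule_zero[OF M_sub(1)] one_mem] by (simp add: scale_one)
  then have "W \<noteq> M" using x_mem(2) by blast
  ultimately have "W = V" using maximal by (auto simp: maximal_submodule_def)
  then show ?thesis using y_mem that by (auto simp: W_def)
qed

lemma maximal_submodule_cyclic_notin: "maximal_submodule (cyclic \<alpha>) M \<Longrightarrow> \<alpha> \<notin> M"
  using cyclic_subset_iff[of M \<alpha>] by (auto simp: maximal_submodule_def)

lemma maximal_submodule_cyclic_prime: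
  assumes maximal: "maximal_submodule (cyclic \<alpha>) M" and ab_mem: "a \<in> R" "b \<in> R" "(a * b) \<cdot> \<alpha> \<in> M"
  shows "a \<cdot> \<alpha> \<in> M \<or> b \<cdot> \<alpha> \<in> M"
proof (cases "a \<cdot> \<alpha> \<in> M")
  case False
  moreover have "a \<cdot> \<alpha> \<in> cyclic \<alpha>" using ab_mem(1) by (auto simp: cyclic_def)
  ultimately obtain m c where decomposition: "m \<in> M" "c \<in> R" "\<alpha> = m + c \<cdot> a \<cdot> \<alpha>"
    using maximal_submodule_span[OF submodule_cyclic maximal _ _ cyclic_self] by blast
  have "b \<cdot> \<alpha> = b \<cdot> m + b \<cdot> c \<cdot> a \<cdot> \<alpha>"
    using decomposition ab_mem by (metis scale_right_distrib)
  also have "b \<cdot> c \<cdot> a \<cdot> \<alpha> = c \<cdot> (a * b) \<cdot> \<alpha>"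
    using decomposition ab_mem by (simp add: scale_scale mult_mem mult_ac)
  finally show ?thesis
    using maximal decomposition ab_mem
    by (auto simp: maximal_submodule_def intro!: submodule_add submodule_scale)
qed simp

lemma maximal_submodule_cyclic_prime_prod:
  assumes maximal: "maximal_submodule (cyclic \<alpha>) M" and "finite I"
    and "\<And>i. i \<in> I \<Longrightarrow> a i \<in> R" "prod a I \<cdot> \<alpha> \<in> M"
  shows "\<exists>i\<in>I. a i \<cdot> \<alpha> \<in> M"
  using assms(2-)
proof (induction I rule: finite_induct)
  case empty
  then show ?case using maximal_submodule_cyclic_notin[OF maximal] by (simp add: scale_one)
next
  case (insert i I)
  then have "a i \<cdot> \<alpha> \<in> M \<or> prod a I \<cdot> \<alpha> \<in> M"
    by (intro maximal_submodule_cyclic_prime[OF maximal]) (auto intro: prod_mem)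
  with insert show ?case by blast
qed

lemma maximal_submodule_cyclic_mem_if_Inter_subset:
  assumes maximal: "maximal_submodule (cyclic \<alpha>) M"
    and all_maximal: "finite \<N>" "\<And>N. N \<in> \<N> \<Longrightarrow> maximal_submodule (cyclic \<alpha>) N"
    and Inter_subset: "\<Inter>(insert (cyclic \<alpha>) \<N>) \<subseteq> M"
  shows "M \<in> \<N>"
proof (rule ccontr)
  assume "M \<notin> \<N>"
  have "\<exists>a\<in>R. a \<cdot> \<alpha> \<in> N - M" if "N \<in> \<N>" for N
  proof -
    have "\<not> N \<subseteq> M"
      using maximal all_maximal(2)[OF that] that \<open>M \<notin> \<N>\<close> unfolding maximal_submodule_def by blast
    then show ?thesis
      using all_maximal(2)[OF that] unfolding maximal_submodule_def cyclic_def by blast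
  qed
  then obtain a where separating: "\<And>N. N \<in> \<N> \<Longrightarrow> a N \<in> R \<and> a N \<cdot> \<alpha> \<in> N - M" by metis
  have "prod a \<N> \<cdot> \<alpha> \<in> N" if "N \<in> \<N>" for N
  proof -
    have "prod a \<N> = prod a (\<N> - {N}) * a N"
      using all_maximal(1) that by (simp add: prod.remove mult.commute)
    moreover have "prod a (\<N> - {N}) \<in> R" using separating by (auto intro: prod_mem)
    ultimately show ?thesis
      using all_maximal(2)[OF that] separating[OF that]
      by (simp add: maximal_submodule_def submodule_scale flip: scale_scale)
  qed
  moreover have "prod a \<N> \<cdot> \<alpha> \<in> cyclic \<alpha>"
    using separating by (auto simp: cyclic_def intro: prod_mem)
  ultimately have "prod a \<N> \<cdot> \<alpha> \<in> M" using Inter_subset by blast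
  then show False
    using maximal_submodule_cyclic_prime_prod[OF maximal all_maximal(1), of a] separating by blast
qed

lemma submodule_Inter_maximal_submodules:
  assumes "\<And>N. N \<in> \<N> \<Longrightarrow> maximal_submodule (cyclic \<alpha>) N"
  shows "submodule (\<Inter>(insert (cyclic \<alpha>) \<N>))"
  using assms submodule_cyclic by (intro submodule_Inter) (auto simp: maximal_submodule_def)

lemma add_mem_Diff_maximal_submodules:
  assumes "\<And>N. N \<in> \<N> \<Longrightarrow> maximal_submodule (cyclic \<alpha>) N"
    and x_mem: "x \<in> \<Inter>(insert (cyclic \<alpha>) \<N>)" and y_mem: "y \<in> cyclic \<alpha> - \<Union>\<N>"
  shows "x + y \<in> cyclic \<alpha> - \<Union>\<N>"
proof -
  have "y \<in> N" if "N \<in> \<N>" "x + y \<in> N" for N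
    using submodule_diff[OF _ that(2), of x] x_mem assms(1)[OF that(1)] that(1)
    by (simp add: maximal_submodule_def)
  moreover have "x + y \<in> cyclic \<alpha>"
    using x_mem y_mem by (auto intro: submodule_add[OF submodule_cyclic])
  ultimately show ?thesis using y_mem by auto
qed

lemma cyclic_eq_if_notin_maximal_submodules:
  assumes "finite (cyclic \<alpha>)" "v \<in> cyclic \<alpha>"
    and "\<And>M. maximal_submodule (cyclic \<alpha>) M \<Longrightarrow> v \<notin> M"
  shows "cyclic v = cyclic \<alpha>"
proof (rule ccontr)
  assume "cyclic v \<noteq> cyclic \<alpha>"
  then have "cyclic v \<subset> cyclic \<alpha>"
    using cyclic_subset_iff[OF submodule_cyclic] assms(2) by blast
  then obtain M where "maximal_submodule (cyclic \<alpha>) M" "cyclic v \<subseteq> M"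
    using maximal_submodule_exists[OF assms(1) submodule_cyclic] by blast
  then show False using assms(3) cyclic_self by blast
qed

end

locale subring_module_unit_differences = subring_module R scale
  for R :: "'r::comm_ring_1 set" and scale :: "'r \<Rightarrow> 'm::ab_group_add \<Rightarrow> 'm" (infixr "\<cdot>" 75) +
  fixes K :: "'r set"
  assumes K_subset: "K \<subseteq> R"
    and unit_differences: "\<lbrakk>c \<in> K; d \<in> K; c \<noteq> d\<rbrakk> \<Longrightarrow> \<exists>u\<in>R. u * (c - d) = 1"
begin

lemma card_mult_card_Int_le:
  assumes "finite A" and M_avoids: "submodule M" "x \<notin> M"
    and A_closed: "\<And>c y. c \<in> K \<Longrightarrow> y \<in> A \<Longrightarrow> c \<cdot> x + y \<in> A"
  shows "card K * card (A \<inter> M) \<le> card A"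
proof -
  have "inj_on (\<lambda>(c, y). c \<cdot> x + y) (K \<times> (A \<inter> M))"
  proof (rule inj_onI, clarify)
    fix c y d z
    assume mems: "c \<in> K" "d \<in> K" "y \<in> M" "z \<in> M" and sums_eq: "c \<cdot> x + y = d \<cdot> x + z"
    have "c = d"
    proof (rule ccontr)
      assume "c \<noteq> d"
      then obtain u where inverse_u: "u \<in> R" "u * (c - d) = 1" using unit_differences mems by blast
      have R_mems: "c \<in> R" "d \<in> R" using mems K_subset by auto
      have "(c - d) \<cdot> x = z - y" using sums_eq R_mems by (simp add: scale_diff_left algebra_simps)
      then have "(c - d) \<cdot> x \<in> M" using submodule_diff[OF M_avoids(1)] mems by simp
      then have "u \<cdot> (c - d) \<cdot> x \<in> M" by (rule submodule_scale[OF M_avoids(1) inverse_u(1)])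
      then show False using inverse_u R_mems M_avoids(2) by (simp add: scale_scale diff_mem scale_one)
    qed
    then show "c = d \<and> y = z" using sums_eq by simp
  qed
  moreover have "(\<lambda>(c, y). c \<cdot> x + y) ` (K \<times> (A \<inter> M)) \<subseteq> A" using A_closed by auto
  ultimately have "card (K \<times> (A \<inter> M)) \<le> card A" using card_inj_on_le assms(1) by blast
  then show ?thesis by (simp add: card_cartesian_product)
qed

lemma card_Inter_insert_maximal_submodule_le:
  assumes "finite (cyclic \<alpha>)" "finite \<N>"
    and "\<And>N. N \<in> \<N> \<Longrightarrow> maximal_submodule (cyclic \<alpha>) N"
    and "maximal_submodule (cyclic \<alpha>) M" "M \<notin> \<N>"
  shows "card K * card (\<Inter>(insert (cyclic \<alpha>) (insert M \<N>))) \<le> card (\<Inter>(insert (cyclic \<alpha>) \<N>))"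
proof -
  define I where "I = \<Inter>(insert (cyclic \<alpha>) \<N>)"
  have submodule_I: "submodule I"
    unfolding I_def by (rule submodule_Inter_maximal_submodules[OF assms(3)])
  obtain x where x_separates: "x \<in> I" "x \<notin> M"
    using maximal_submodule_cyclic_mem_if_Inter_subset[OF assms(4,2,3)] assms(5)
    by (auto simp: I_def)
  have "c \<cdot> x + y \<in> I" if "c \<in> K" "y \<in> I" for c y
    using that submodule_I x_separates(1) K_subset by (auto intro: submodule_add submodule_scale)
  then have "card K * card (I \<inter> M) \<le> card I"
    using assms(1,4) x_separates(2)
    by (intro card_mult_card_Int_le) (auto simp: I_def maximal_submodule_def)
  then show ?thesis by (simp add: I_def Int_ac)
qed

lemma card_Diff_insert_maximal_submodule_ge:
  assumes "finite (cyclic \<alpha>)" "finite \<N>"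
    and "\<And>N. N \<in> \<N> \<Longrightarrow> maximal_submodule (cyclic \<alpha>) N"
    and "maximal_submodule (cyclic \<alpha>) M" "M \<notin> \<N>"
  shows "(card K - 1) * card (cyclic \<alpha> - \<Union>\<N>) \<le> card K * card (cyclic \<alpha> - \<Union>(insert M \<N>))"
proof -
  define I where "I = \<Inter>(insert (cyclic \<alpha>) \<N>)"
  define A where "A = cyclic \<alpha> - \<Union>\<N>"
  have submodule_I: "submodule I"
    unfolding I_def by (rule submodule_Inter_maximal_submodules[OF assms(3)])
  obtain x where x_separates: "x \<in> I" "x \<notin> M"
    using maximal_submodule_cyclic_mem_if_Inter_subset[OF assms(4,2,3)] assms(5)
    by (auto simp: I_def)
  have "c \<cdot> x + y \<in> A" if "c \<in> K" "y \<in> A" for c y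
  proof -
    have "c \<cdot> x \<in> I"
      using that(1) submodule_I x_separates(1) K_subset by (auto intro: submodule_scale)
    then show ?thesis
      using that(2) assms(3) unfolding A_def I_def by (intro add_mem_Diff_maximal_submodules)
  qed
  then have "card K * card (A \<inter> M) \<le> card A"
    using assms(1,4) x_separates(2)
    by (intro card_mult_card_Int_le) (auto simp: A_def maximal_submodule_def)
  moreover have "card A = card (A \<inter> M) + card (A - M)"
    using assms(1) card_Int_Diff[of A M] by (simp add: A_def)
  ultimately have "(card K - 1) * card A \<le> card K * card (A - M)"
    by (cases "card K") (simp_all add: distrib_left)
  then show ?thesis by (simp add: A_def Diff_eq Int_ac)
qed

lemma
  assumes "finite (cyclic \<alpha>)" "finite \<N>" "\<And>N. N \<in> \<N> \<Longrightarrow> maximal_submodule (cyclic \<alpha>) N"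
  shows card_Inter_maximal_submodules_le:
      "card (\<Inter>(insert (cyclic \<alpha>) \<N>)) * card K ^ card \<N> \<le> card (cyclic \<alpha>)"
    and card_Diff_maximal_submodules_ge:
      "card (cyclic \<alpha>) * (card K - 1) ^ card \<N> \<le> card (cyclic \<alpha> - \<Union>\<N>) * card K ^ card \<N>"
  using assms(2) subset_refl
proof (induction \<N> rule: finite_subset_induct')
  case (insert M \<N>')
  have maximal_rest: "maximal_submodule (cyclic \<alpha>) N" if "N \<in> \<N>'" for N
    using assms(3) insert.hyps(3) that by blast
  note step_assms = assms(1) insert.hyps(1) maximal_rest assms(3)[OF insert.hyps(2)] insert.hyps(4)
  {
    case 1
    have "card (\<Inter>(insert (cyclic \<alpha>) (insert M \<N>'))) * card K ^ card (insert M \<N>') =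
        (card K * card (\<Inter>(insert (cyclic \<alpha>) (insert M \<N>')))) * card K ^ card \<N>'"
      using insert.hyps by simp
    also have "\<dots> \<le> card (\<Inter>(insert (cyclic \<alpha>) \<N>')) * card K ^ card \<N>'"
      by (intro mult_right_mono card_Inter_insert_maximal_submodule_le[OF step_assms]) auto
    also have "\<dots> \<le> card (cyclic \<alpha>)" by (rule insert.IH(1))
    finally show ?case .
  next
    case 2
    have "card (cyclic \<alpha>) * (card K - 1) ^ card (insert M \<N>') =
        (card K - 1) * (card (cyclic \<alpha>) * (card K - 1) ^ card \<N>')"
      using insert.hyps by simp
    also have "\<dots> \<le> (card K - 1) * (card (cyclic \<alpha> - \<Union>\<N>') * card K ^ card \<N>')"
      by (intro mult_left_mono insert.IH(2)) auto
    also have "\<dots> \<le> card K * card (cyclic \<alpha> - \<Union>(insert M \<N>')) * card K ^ card \<N>'"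
      unfolding mult.assoc[symmetric]
      by (intro mult_right_mono card_Diff_insert_maximal_submodule_ge[OF step_assms]) auto
    finally show ?case using insert.hyps by (simp add: mult_ac)
  }
qed auto

theorem card_generators_cyclic_ge:
  assumes card_cyclic: "card (cyclic \<alpha>) = card K ^ r" and card_K: "card K > 1"
  shows "(card K - 1) ^ r \<le> card {v. cyclic v = cyclic \<alpha>}"
proof -
  define \<N> where "\<N> = {M. maximal_submodule (cyclic \<alpha>) M}"
  have finite_cyclic: "finite (cyclic \<alpha>)" using card_cyclic card_K by (intro card_ge_0_finite) simp
  have "finite \<N>"
    by (rule finite_subset[of _ "Pow (cyclic \<alpha>)"])
      (use finite_cyclic in \<open>auto simp: \<N>_def maximal_submodule_def\<close>)
  define s where "s = card \<N>"
  have all_maximal: "maximal_submodule (cyclic \<alpha>) N" if "N \<in> \<N>" for N using that by (simp add: \<N>_def)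
  have "submodule (\<Inter>(insert (cyclic \<alpha>) \<N>))"
    by (rule submodule_Inter_maximal_submodules[OF all_maximal])
  then have "card (\<Inter>(insert (cyclic \<alpha>) \<N>)) > 0"
    using finite_cyclic submodule_zero by (auto simp: card_gt_0_iff)
  then have "card K ^ s \<le> card K ^ r"
    using card_Inter_maximal_submodules_le[OF finite_cyclic \<open>finite \<N>\<close> all_maximal]
    by (simp add: card_cyclic s_def) (metis Suc_leI le_trans mult_le_mono1 nat_mult_1 One_nat_def)
  then have "s \<le> r" using card_K by simp
  have "(card K - 1) ^ r * card K ^ s = (card K - 1) ^ (r - s) * ((card K - 1) ^ s * card K ^ s)"
    using \<open>s \<le> r\<close> by (simp flip: power_add mult.assoc)
  also have "\<dots> \<le> card K ^ (r - s) * ((card K - 1) ^ s * card K ^ s)"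
    by (intro mult_right_mono power_mono) auto
  also have "\<dots> = card (cyclic \<alpha>) * (card K - 1) ^ s"
    using \<open>s \<le> r\<close> by (simp add: card_cyclic mult_ac flip: power_add)
  also have "\<dots> \<le> card (cyclic \<alpha> - \<Union>\<N>) * card K ^ s"
    unfolding s_def
    by (rule card_Diff_maximal_submodules_ge[OF finite_cyclic \<open>finite \<N>\<close> all_maximal])
  finally have "(card K - 1) ^ r \<le> card (cyclic \<alpha> - \<Union>\<N>)" using card_K by simp
  also have "\<dots> \<le> card {v. cyclic v = cyclic \<alpha>}"
  proof (rule card_mono)
    show "finite {v. cyclic v = cyclic \<alpha>}"
      using finite_cyclic cyclic_self by (auto intro: finite_subset)
    show "cyclic \<alpha> - \<Union>\<N> \<subseteq> {v. cyclic v = cyclic \<alpha>}"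
      using cyclic_eq_if_notin_maximal_submodules[OF finite_cyclic] by (auto simp: \<N>_def)
  qed
  finally show ?thesis .
qed

end

subsection \<open>Counting \<open>k\<close>-normal elements\<close>

lemma primepow_ge_2: "primepow q \<Longrightarrow> q \<ge> (2::nat)"
  using primepow_gt_Suc_0[of q] by simp

lemma add_power_primepow:
  fixes x y :: "'a::{field,finite}"
  assumes "primepow q" "CARD('a) = q ^ n"
  shows "(x + y) ^ q = x ^ q + y ^ q"
proof -
  from assms(1) obtain p e where q_eq: "prime p" "q = p ^ e" by (auto simp: primepow_def)
  have prime_char: "prime CHAR('a)" by (intro prime_CHAR_semidom finite_imp_CHAR_pos) simp
  moreover have "CHAR('a) dvd p ^ (e * n)"
    using CHAR_dvd_CARD[where ?'a = 'a] assms(2) q_eq by (simp add: power_mult)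
  ultimately have "CHAR('a) = p"
    using q_eq by (meson prime_dvd_power primes_dvd_imp_eq)
  then show ?thesis using freshmans_dream'[OF prime_char] q_eq(2) by blast
qed

lemma card_Fq:
  assumes q_ge_2: "q \<ge> 2" and card_UNIV: "CARD('a::{field,finite}) = q ^ n"
  shows "card (Fq q :: 'a set) = q"
proof -
  have "x ^ q = x \<longleftrightarrow> x = 0 \<or> x ^ (q - 1) = 1" for x :: 'a
    using q_ge_2 by (cases q) auto
  then have "Fq q = insert 0 {x::'a. x ^ (q - 1) = 1}" by (auto simp: Fq_def)
  moreover have "[q ^ n = 1 ^ n] (mod (q - 1))"
    using q_ge_2 by (intro cong_pow) (simp add: cong_altdef_nat)
  then have "q - 1 dvd q ^ n - 1"
    using q_ge_2 cong_altdef_nat[of 1 "q ^ n" "q - 1"] by simp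
  then have "card {x::'a. x ^ (q - 1) = 1} = q - 1"
    by (intro card_roots_of_unity) (simp add: card_UNIV)
  ultimately show ?thesis using q_ge_2 by (simp add: power_0_left)
qed

definition linearized :: "nat \<Rightarrow> 'a::field poly \<Rightarrow> 'a \<Rightarrow> 'a" where
  "linearized q p v = (\<Sum>i\<le>degree p. poly.coeff p i * v ^ (q ^ i))"

definition Fq_poly :: "nat \<Rightarrow> 'a::field poly set" where
  "Fq_poly q = {p. \<forall>i. poly.coeff p i \<in> Fq q}"

lemma linearized_altdef:
  assumes "degree p \<le> N"
  shows "linearized q p v = (\<Sum>i\<le>N. poly.coeff p i * v ^ (q ^ i))"
  unfolding linearized_def using assms
  by (intro sum.mono_neutral_left) (auto simp: coeff_eq_0)

lemma linearized_add: "linearized q (p + r) v = linearized q p v + linearized q r v"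
proof -
  define N where "N = max (degree p) (degree r)"
  have "degree (p + r) \<le> N" unfolding N_def by (rule degree_add_le_max)
  then show ?thesis
    using linearized_altdef[of _ N q v]
    by (simp add: N_def distrib_right flip: sum.distrib)
qed

lemma linearized_smult: "linearized q (Polynomial.smult c p) v = c * linearized q p v"
  using linearized_altdef[of "Polynomial.smult c p" "degree p" q v]
  by (simp add: linearized_def degree_smult_le sum_distrib_left mult.assoc)

lemma linearized_monom: "linearized q (Polynomial.monom c i) v = c * v ^ (q ^ i)"
proof -
  have "linearized q (Polynomial.monom c i) v = (\<Sum>j\<le>i. if j = i then c * v ^ (q ^ j) else 0)"
    by (subst linearized_altdef[OF degree_monom_le]) (intro sum.cong, auto)
  then show ?thesis by simp
qed

lemma lin_span_eq_image:
  assumes "finite S" "0 \<in> K"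
  shows "lin_span K S = (\<lambda>c. \<Sum>b\<in>S. c b * b) ` (S \<rightarrow>\<^sub>E K)"
proof (intro equalityI subsetI)
  fix x assume "x \<in> lin_span K S"
  then obtain B c where combination: "finite B" "B \<subseteq> S" "\<forall>b\<in>B. c b \<in> K" "x = (\<Sum>b\<in>B. c b * b)"
    unfolding lin_span_def by blast
  define d where "d = (\<lambda>b\<in>S. if b \<in> B then c b else 0)"
  have "x = (\<Sum>b\<in>S. d b * b)"
    unfolding combination(4) using assms combination(2)
    by (intro sum.mono_neutral_cong_left) (auto simp: d_def)
  moreover have "d \<in> S \<rightarrow>\<^sub>E K" using combination assms by (auto simp: d_def)
  ultimately show "x \<in> (\<lambda>c. \<Sum>b\<in>S. c b * b) ` (S \<rightarrow>\<^sub>E K)" by blast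
next
  fix x assume "x \<in> (\<lambda>c. \<Sum>b\<in>S. c b * b) ` (S \<rightarrow>\<^sub>E K)"
  then show "x \<in> lin_span K S" unfolding lin_span_def using assms by blast
qed

lemma lin_span_sum_mem:
  assumes K_closed: "0 \<in> K" "\<And>c d. c \<in> K \<Longrightarrow> d \<in> K \<Longrightarrow> c + d \<in> K"
    and coeffs_mem: "\<And>i. i \<in> I \<Longrightarrow> c i \<in> K" and vectors_mem: "\<And>i. i \<in> I \<Longrightarrow> b i \<in> S"
  shows "(\<Sum>i\<in>I. c i * b i) \<in> lin_span K S"
proof (cases "finite I")
  case True
  have K_sum: "sum c J \<in> K" if "J \<subseteq> I" for J
    using that by (induction J rule: infinite_finite_induct) (auto intro: K_closed coeffs_mem)
  have "(\<Sum>i\<in>I. c i * b i) = (\<Sum>x\<in>b ` I. \<Sum>i | i \<in> I \<and> b i = x. c i * b i)"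
    using True by (rule sum.image_gen)
  also have "\<dots> = (\<Sum>x\<in>b ` I. (\<Sum>i | i \<in> I \<and> b i = x. c i) * x)"
    by (simp add: sum_distrib_right)
  also have "\<dots> \<in> lin_span K S"
    using True vectors_mem K_sum unfolding lin_span_def
    by (intro CollectI exI[of _ "b ` I"] exI[of _ "\<lambda>x. \<Sum>i | i \<in> I \<and> b i = x. c i"]) auto
  finally show ?thesis .
next
  case False
  then show ?thesis unfolding lin_span_def by (intro CollectI exI[of _ "{}"]) simp
qed

lemma card_has_dim:
  assumes dim_V: "has_dim K V d"
    and K_closed: "finite K" "0 \<in> K" "\<And>c d. c \<in> K \<Longrightarrow> d \<in> K \<Longrightarrow> c - d \<in> K"
  shows "card V = card K ^ d"
proof -
  obtain B where basis: "lin_indep K B" "lin_span K B = V" "card B = d"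
    using dim_V unfolding has_dim_def by blast
  have finite_B: "finite B" using basis(1) by (simp add: lin_indep_def)
  have "inj_on (\<lambda>c. \<Sum>b\<in>B. c b * b) (B \<rightarrow>\<^sub>E K)"
  proof (rule inj_onI)
    fix c e
    assume coeffs: "c \<in> B \<rightarrow>\<^sub>E K" "e \<in> B \<rightarrow>\<^sub>E K" "(\<Sum>b\<in>B. c b * b) = (\<Sum>b\<in>B. e b * b)"
    then have "(\<Sum>b\<in>B. (c b - e b) * b) = 0" by (simp add: left_diff_distrib sum_subtractf)
    moreover have "\<forall>b\<in>B. c b - e b \<in> K" using coeffs(1,2) by (blast intro: K_closed(3))
    ultimately have "\<forall>b\<in>B. c b - e b = 0"
      using basis(1)[unfolded lin_indep_def, THEN conjunct2, THEN spec[of _ "\<lambda>b. c b - e b"]] by blast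
    then show "c = e" using coeffs by (intro PiE_ext[of c B _ e]) auto
  qed
  then have "card (lin_span K B) = card (B \<rightarrow>\<^sub>E K)"
    unfolding lin_span_eq_image[OF finite_B K_closed(2)] by (rule card_image)
  then show ?thesis using basis finite_B by (simp add: card_PiE)
qed

context
  fixes q n :: nat
  assumes primepow_q: "primepow q" and card_UNIV: "CARD('a::{field,finite}) = q ^ n"
begin

lemma power_q_add: "(x + y) ^ q = x ^ q + (y::'a) ^ q"
  by (rule add_power_primepow[OF primepow_q card_UNIV])

lemma power_q_diff: "(x - y) ^ q = x ^ q - (y::'a) ^ q"
  by (simp add: eq_diff_eq flip: power_q_add)

lemma power_q_sum: "sum f A ^ q = (\<Sum>i\<in>A. (f i::'a) ^ q)"
  using primepow_ge_2[OF primepow_q]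
  by (induction A rule: infinite_finite_induct) (auto simp: power_q_add power_0_left)

lemma power_q_power_add: "(x + y) ^ (q ^ i) = x ^ (q ^ i) + (y::'a) ^ (q ^ i)"
  by (induction i) (simp_all add: power_mult power_q_add mult.commute[of q])

lemma
  shows Fq_0: "0 \<in> (Fq q :: 'a set)"
    and Fq_1: "1 \<in> (Fq q :: 'a set)"
    and Fq_add: "\<lbrakk>c \<in> Fq q; d \<in> Fq q\<rbrakk> \<Longrightarrow> c + d \<in> (Fq q :: 'a set)"
    and Fq_diff: "\<lbrakk>c \<in> Fq q; d \<in> Fq q\<rbrakk> \<Longrightarrow> c - d \<in> (Fq q :: 'a set)"
    and Fq_mult: "\<lbrakk>c \<in> Fq q; d \<in> Fq q\<rbrakk> \<Longrightarrow> c * d \<in> (Fq q :: 'a set)"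
    and Fq_inverse: "c \<in> Fq q \<Longrightarrow> inverse c \<in> (Fq q :: 'a set)"
  using primepow_ge_2[OF primepow_q]
  by (auto simp: Fq_def power_q_add power_q_diff power_mult_distrib power_inverse)

lemma Fq_sum: "(\<And>i. i \<in> A \<Longrightarrow> f i \<in> Fq q) \<Longrightarrow> sum f A \<in> (Fq q :: 'a set)"
  by (induction A rule: infinite_finite_induct) (auto intro: Fq_0 Fq_add)

lemma Fq_poly_pCons_iff: "pCons c p \<in> Fq_poly q \<longleftrightarrow> (c::'a) \<in> Fq q \<and> p \<in> Fq_poly q"
  by (auto simp: Fq_poly_def coeff_pCons split: nat.splits)

lemma Fq_poly_const_iff: "[:c:] \<in> Fq_poly q \<longleftrightarrow> c \<in> (Fq q :: 'a set)"
  unfolding Fq_poly_pCons_iff by (simp add: Fq_poly_def Fq_0)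

lemma Fq_poly_monom: "Polynomial.monom 1 i \<in> (Fq_poly q :: 'a poly set)"
  by (simp add: Fq_poly_def Fq_0 Fq_1)

lemma
  fixes p r :: "'a poly"
  assumes "p \<in> Fq_poly q" "r \<in> Fq_poly q"
  shows Fq_poly_diff: "p - r \<in> Fq_poly q"
    and Fq_poly_mult: "p * r \<in> Fq_poly q"
  using assms by (auto simp: Fq_poly_def coeff_mult intro!: Fq_diff Fq_sum Fq_mult)

lemma linearized_power_q:
  assumes "p \<in> Fq_poly q"
  shows "linearized q p (v::'a) ^ q = linearized q (pCons 0 p) v"
proof -
  have "poly.coeff p i ^ q = poly.coeff p i" for i
    using assms by (simp add: Fq_poly_def Fq_def)
  then have "linearized q p v ^ q = (\<Sum>i\<le>degree p. poly.coeff p i * v ^ (q ^ Suc i))"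
    by (simp add: linearized_def power_q_sum power_mult_distrib mult.commute[of q] flip: power_mult)
  also have "\<dots> = linearized q (pCons 0 p) v"
    by (subst linearized_altdef[OF degree_pCons_le], subst sum.atMost_Suc_shift)
      (simp del: power_Suc)
  finally show ?thesis .
qed

lemma linearized_mult:
  assumes "p \<in> Fq_poly q" "r \<in> Fq_poly q"
  shows "linearized q (p * r) (v::'a) = linearized q p (linearized q r v)"
  using assms(1)
proof (induction p)
  case 0
  then show ?case by (simp add: linearized_def)
next
  case (pCons c p)
  let ?w = "linearized q r v"
  have p_mem: "p \<in> Fq_poly q" using pCons.prems by (simp add: Fq_poly_pCons_iff)
  have "linearized q (pCons c p * r) v = c * ?w + linearized q (p * r) v ^ q"
    using linearized_power_q[OF Fq_poly_mult[OF p_mem assms(2)], of v]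
    by (simp add: linearized_add linearized_smult)
  also have "\<dots> = linearized q [:c:] ?w + linearized q (pCons 0 p) ?w"
    using pCons.IH[OF p_mem] linearized_power_q[OF p_mem] by (simp add: linearized_def)
  also have "\<dots> = linearized q (pCons c p) ?w" by (simp flip: linearized_add)
  finally show ?case .
qed

lemma subring_module_linearized:
  "subring_module_unit_differences (Fq_poly q) (linearized q) ((\<lambda>c::'a. [:c:]) ` Fq q)"
proof
  show "1 \<in> (Fq_poly q :: 'a poly set)" using Fq_poly_monom[of 0] by simp
  show "linearized q p (x + y) = linearized q p x + linearized q p y" for p and x y :: 'a
    by (simp add: linearized_def power_q_power_add distrib_left sum.distrib)
  show "linearized q 1 x = (x::'a)" for x
    by (simp add: linearized_def)
  show "\<exists>u\<in>Fq_poly q. u * (c - d) = 1"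
    if "c \<in> (\<lambda>c::'a. [:c:]) ` Fq q" "d \<in> (\<lambda>c. [:c:]) ` Fq q" "c \<noteq> d" for c d
  proof -
    from that obtain a b where constants: "c = [:a:]" "d = [:b:]" "a \<in> Fq q" "b \<in> Fq q" "a \<noteq> b"
      by auto
    then show ?thesis
      by (intro bexI[of _ "[:inverse (a - b):]"])
        (auto simp: Fq_poly_const_iff one_pCons intro!: Fq_inverse Fq_diff)
  qed
qed (auto simp: Fq_poly_diff Fq_poly_mult linearized_add linearized_mult Fq_poly_const_iff)

interpretation subring_module_unit_differences "Fq_poly q" "linearized q" "(\<lambda>c::'a. [:c:]) ` Fq q"
  by (rule subring_module_linearized)

lemma power_card_eq_self: "x ^ (q ^ n) = (x::'a)"
proof (cases "x = 0")
  case False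
  have "x ^ (CARD('a) - 1) = 1"
    using mult_ord_dvd_iff[OF False] mult_ord_dvd_card_minus_1[OF False] by blast
  then show ?thesis
    using power_minus_mult[of "q ^ n" x] primepow_ge_2[OF primepow_q] by (simp add: card_UNIV)
qed (use primepow_ge_2[OF primepow_q] in auto)

lemma power_q_power_mod: "x ^ (q ^ (i mod n)) = (x::'a) ^ (q ^ i)"
proof -
  have "x ^ (q ^ (n * j)) = x" for j
    by (induction j) (simp_all add: power_add power_mult power_card_eq_self)
  then have "x ^ (q ^ (n * (i div n) + i mod n)) = x ^ (q ^ (i mod n))"
    by (simp only: power_add power_mult)
  then show ?thesis by simp
qed

lemma lin_span_conjugates_eq_cyclic: "lin_span (Fq q) {v ^ (q ^ i) | i. i < n} = cyclic (v::'a)"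
proof (intro equalityI subsetI)
  fix x assume "x \<in> lin_span (Fq q) {v ^ (q ^ i) | i. i < n}"
  then obtain B c where combination:
    "B \<subseteq> {v ^ (q ^ i) | i. i < n}" "\<forall>b\<in>B. c b \<in> Fq q" "x = (\<Sum>b\<in>B. c b * b)"
    unfolding lin_span_def by blast
  have "c b * b \<in> cyclic v" if b_mem: "b \<in> B" for b
  proof -
    obtain i where "b = v ^ (q ^ i)" using combination(1) b_mem by blast
    then have "c b * b = linearized q [:c b:] (linearized q (Polynomial.monom 1 i) v)"
      by (simp add: linearized_monom flip: monom_0)
    also have "\<dots> \<in> cyclic v"
      using combination(2) b_mem Fq_poly_monom cyclic_self
      by (intro submodule_scale[OF submodule_cyclic]) (auto simp: Fq_poly_const_iff)
    finally show ?thesis .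
  qed
  then show "x \<in> cyclic v"
    unfolding combination(3)
    by (induction B rule: infinite_finite_induct)
      (auto intro: submodule_zero submodule_add submodule_cyclic)
next
  fix x assume "x \<in> cyclic v"
  then obtain p where p_props: "p \<in> Fq_poly q" "x = linearized q p v" by (auto simp: cyclic_def)
  have "n > 0" using card_UNIV card_field_gt_1[where ?'a = 'a] by (cases n) auto
  then have "v ^ (q ^ i) \<in> {v ^ (q ^ i) | i. i < n}" for i
    by (intro CollectI exI[of _ "i mod n"]) (simp add: power_q_power_mod)
  then show "x \<in> lin_span (Fq q) {v ^ (q ^ i) | i. i < n}"
    unfolding p_props(2) linearized_def using p_props(1)
    by (intro lin_span_sum_mem) (auto simp: Fq_poly_def Fq_0 Fq_add)
qed

lemma card_Fq_poly_const: "card ((\<lambda>c::'a. [:c:]) ` Fq q) = q"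
  using card_Fq[OF primepow_ge_2[OF primepow_q] card_UNIV] by (simp add: card_image inj_on_def)

lemma k_normal_iff_cyclic: "k_normal q n k (v::'a) \<longleftrightarrow> has_dim (Fq q) (cyclic v) (n - k)"
  unfolding k_normal_def lin_span_conjugates_eq_cyclic ..

lemma card_cyclic_k_normal:
  assumes "k_normal q n k (v::'a)"
  shows "card (cyclic v) = q ^ (n - k)"
proof -
  have "card (cyclic v) = card (Fq q :: 'a set) ^ (n - k)"
    using assms Fq_0 Fq_diff by (intro card_has_dim) (auto simp: k_normal_iff_cyclic)
  then show ?thesis using card_Fq[OF primepow_ge_2[OF primepow_q] card_UNIV] by simp
qed

lemma card_k_normal_ge:
  assumes "k_normal q n k (\<alpha>::'a)"
  shows "(q - 1) ^ (n - k) \<le> card {v::'a. k_normal q n k v}"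
proof -
  have "(q - 1) ^ (n - k) \<le> card {v. cyclic v = cyclic \<alpha>}"
    using card_generators_cyclic_ge[of \<alpha> "n - k"] card_cyclic_k_normal[OF assms]
      card_Fq_poly_const primepow_ge_2[OF primepow_q] by simp
  also have "\<dots> \<le> card {v::'a. k_normal q n k v}"
    using assms by (intro card_mono) (auto simp: k_normal_iff_cyclic)
  finally show ?thesis .
qed

lemma k_normal_nonzero:
  assumes "k_normal q n k (v::'a)" "k < n"
  shows "v \<noteq> 0"
proof
  assume "v = 0"
  moreover have "submodule {0}" by (simp add: submodule_def scale_zero_right)
  ultimately have "cyclic v \<subseteq> {0}" by (simp add: cyclic_subset_iff)
  then have "card (cyclic v) \<le> card {0::'a}" by (rule card_mono[rotated]) simp
  moreover have "1 < q ^ (n - k)"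
    using primepow_ge_2[OF primepow_q] assms(2) by (intro one_less_power) auto
  ultimately show False using card_cyclic_k_normal[OF assms(1)] by simp
qed

end

subsection \<open>Elements of large order\<close>

lemma four_powr_uminus_le:
  fixes s :: real
  assumes "0 \<le> s" "s \<le> 1 / 2"
  shows "4 powr (- s) \<le> 1 - s"
proof -
  have "convex_on UNIV (exp :: real \<Rightarrow> real)" by (rule exp_convex)
  from convex_onD[OF this, of "2 * s" 0 "- ln 2"] assms
  have "exp (2 * s * (- ln 2)) \<le> (1 - 2 * s) + 2 * s * exp (- ln 2)" by simp
  moreover have "ln (4::real) = 2 * ln 2" using ln_realpow[of "2::real" 2] by simp
  ultimately show ?thesis by (simp add: powr_def exp_minus algebra_simps)
qed

lemma power_mult_four_powr_le:
  assumes "q \<ge> 2"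
  shows "real q ^ r * 4 powr (- real r / real q) \<le> real ((q - 1) ^ r)"
proof -
  have "4 powr (- (1 / real q)) \<le> 1 - 1 / real q"
    using assms by (intro four_powr_uminus_le) (auto simp: field_simps)
  then have "(4 powr (- (1 / real q))) ^ r \<le> (1 - 1 / real q) ^ r"
    by (intro power_mono) auto
  then have "real q ^ r * (4 powr (- (1 / real q))) ^ r \<le> (real q * (1 - 1 / real q)) ^ r"
    unfolding power_mult_distrib by (intro mult_left_mono) auto
  moreover have "(4 powr (- (1 / real q))) ^ r = 4 powr (- real r / real q)"
    by (simp add: powr_power)
  moreover have "real q * (1 - 1 / real q) = real (q - 1)"
    using assms by (simp add: right_diff_distrib of_nat_diff)
  ultimately show ?thesis by simp
qed

lemma tau_mult_totient_ratio_sum_le: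
  assumes q_ge_2: "q \<ge> 2" and n_ge_2: "n \<ge> 2" and k_le: "k \<le> n"
  shows "tau k q n * totient_ratio_sum (q ^ n - 1) \<le> real ((q - 1) ^ (n - k))"
proof -
  define m where "m = q ^ n - 1"
  define \<delta> where "\<delta> = 1.1 / ln (ln (real m))"
  have "(2::nat) ^ 2 \<le> q ^ n"
    using q_ge_2 n_ge_2 by (meson le_trans one_le_numeral power_increasing power_mono zero_le)
  then have m_ge_3: "m \<ge> 3" and m_eq: "real m = real q ^ n - 1" by (auto simp: m_def of_nat_diff)
  have "totient_ratio_sum m \<le> real m powr \<delta>"
    unfolding \<delta>_def by (rule totient_ratio_sum_le_powr[OF m_ge_3])
  also have "\<dots> \<le> (real q ^ n) powr \<delta>"
    using ln_nat_gt_1[OF m_ge_3] m_eq by (intro powr_mono2) (auto simp: \<delta>_def)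
  also have "\<dots> = real q powr (real n * \<delta>)"
    using q_ge_2 by (simp add: powr_powr flip: powr_realpow)
  finally have "tau k q n * totient_ratio_sum m \<le> tau k q n * real q powr (real n * \<delta>)"
    by (intro mult_left_mono) (auto simp: tau_def)
  also have "\<dots> = real q ^ (n - k) * 4 powr (- real (n - k) / real q)"
  proof -
    have "tau k q n = 4 powr (- real (n - k) / real q) * real q powr (real (n - k) - real n * \<delta>)"
      using k_le by (simp add: tau_def \<delta>_def m_eq of_nat_diff algebra_simps)
    then show ?thesis using q_ge_2 by (simp add: powr_diff powr_realpow)
  qed
  also have "\<dots> \<le> real ((q - 1) ^ (n - k))" by (rule power_mult_four_powr_le[OF q_ge_2])
  finally show ?thesis by (simp add: m_def)
qed

theorem theorem4p1:
  fixes q n k :: nat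
  assumes "primepow q"
    and "n \<ge> 2"
    and "k \<le> n - 1"
    and "CARD('a::{field,finite}) = q ^ n"
    and "\<exists>\<alpha>::'a. k_normal q n k \<alpha>"
  shows "\<exists>\<alpha>::'a. k_normal q n k \<alpha> \<and> real (mult_ord \<alpha>) \<ge> tau k q n"
proof -
  let ?A = "{\<alpha>::'a. k_normal q n k \<alpha>}" and ?F = "totient_ratio_sum (q ^ n - 1)"
  obtain \<alpha>\<^sub>0 :: 'a where \<alpha>\<^sub>0: "k_normal q n k \<alpha>\<^sub>0" using assms(5) by blast
  have "0 \<notin> ?A" using k_normal_nonzero[OF assms(1,4)] assms(2,3) by fastforce
  then obtain x where large_order: "x \<in> ?A" "real (card ?A) \<le> real (mult_ord x) * ?F"
    using mult_ord_ge_exists[of ?A] \<alpha>\<^sub>0 assms(4) by auto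
  have "tau k q n * ?F \<le> real ((q - 1) ^ (n - k))"
    using assms(3)
    by (intro tau_mult_totient_ratio_sum_le[OF primepow_ge_2[OF assms(1)] assms(2)]) simp
  also have "\<dots> \<le> real (card ?A)" using card_k_normal_ge[OF assms(1,4) \<alpha>\<^sub>0] by simp
  also note large_order(2)
  finally have "tau k q n * ?F \<le> real (mult_ord x) * ?F" .
  moreover have "?F > 0"
    using card_field_gt_1[where ?'a = 'a] assms(4) by (intro totient_ratio_sum_pos) simp
  ultimately show ?thesis using large_order(1) by auto
qed

end
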